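(* Let $(\mathcal X,\mathcal A,\mu)$ be a sigma-finite measure space, $R:\mathcal X\times\mathcal X\to(0,\infty)$ measurable, and suppose the integral operator $T(f)[y]=\int_{\mathcal X}R(x,y)f(x)\,\mu(dx)$ is a compact operator on $L^2(\mathcal X,\mu)$. Let $r=r(T)$ be its spectral radius and let $v$ and $w$ be the a.e. positive eigenfunctions of $T$ and $T^*$ corresponding to $r$, with $\langle v,w\rangle=1$. Define projection operators $P_{v,w}$ and $Q_{v,w}$ on $L^2(\mathcal X,\mu)$ by $$P_{v,w}(f)[x]=\langle f,w\rangle v(x),\qquad Q_{v,w}(f)[x]=f(x)-\langle f,w\rangle v(x),$$ so that $f=P_{v,w}(f)+Q_{v,w}(f)$. Then for any $f\in L^2(\mathcal X,\mu)$, $$T^k(f)=r^k\langle f,w\rangle v+(TQ_{v,w})^k(f),\qquad k\ge1.$$ Further, given any $\varepsilon>0$, there exists a constant $C_\varepsilon>0$ such that $$\|(TQ_{v,w})^k\|_{\mathrm{op}}<C_\varepsilon(|\lambda_2|+\varepsilon)^k,\qquad k\ge1,$$ where $|\lambda_2|:=\sup\{|\lambda|:\lambda\in\sigma(T),\lambda\ne r\}$. In particular, for any $f\in L^2(\mathcal X,\mu)$ with $\langle f,w\rangle\ne0$, $$\Big\|\frac{T^k(f)}{r^k\langle f,w\rangle}-v\Big\|\le C_\varepsilon\,|\langle f,w\rangle|^{-1}\,\|f\|\,\Big(\frac{|\lambda_2|+\varepsilon}{r}\Big)^k,\qquad k\ge1.$$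
   Context: $L^2(\mathcal X,\mu)$ is the space of complex-valued square-integrable functions with $\langle f,g\rangle=\int f\bar g\,d\mu$ and norm $\|\cdot\|$; $\|\cdot\|_{\mathrm{op}}$ is the induced operator norm; $\sigma(T)$ is the spectrum of $T$. The adjoint is $T^*(f)[y]=\int R(y,x)f(x)\,\mu(dx)$ and $r(T^* )=r(T)$. By the Krein–Rutman theorem (for compact integral operators with a.e. strictly positive kernel), $r>0$ is an eigenvalue of $T$ and of $T^*$ with a one-dimensional eigenspace spanned by an a.e. positive eigenfunction, and every other eigenvalue has modulus strictly less than $r$. The supremum over the empty set is taken to be $0$. *)

theory Defs
  imports "HOL-Analysis.Analysis"
begin

text \<open>
  Elements of complex \<open>L\<^sup>2(M)\<close> are handled through representatives: functions \<open>'a \<Rightarrow> complex\<close>,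
  with identities between them understood almost everywhere.  Operators act on representatives.
\<close>

definition L2 :: "'a measure \<Rightarrow> ('a \<Rightarrow> complex) set" where
  "L2 M = {f. f \<in> borel_measurable M \<and> integrable M (\<lambda>x. (cmod (f x))\<^sup>2)}"

definition inner_L2 :: "'a measure \<Rightarrow> ('a \<Rightarrow> complex) \<Rightarrow> ('a \<Rightarrow> complex) \<Rightarrow> complex" where
  "inner_L2 M f g = (LINT x|M. f x * cnj (g x))"

definition norm_L2 :: "'a measure \<Rightarrow> ('a \<Rightarrow> complex) \<Rightarrow> real" where
  "norm_L2 M f = sqrt (LINT x|M. (cmod (f x))\<^sup>2)"

definition linear_L2 :: "'a measure \<Rightarrow> (('a \<Rightarrow> complex) \<Rightarrow> ('a \<Rightarrow> complex)) \<Rightarrow> bool" where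
  "linear_L2 M A \<longleftrightarrow>
     (\<forall>f \<in> L2 M. A f \<in> L2 M) \<and>
     (\<forall>f \<in> L2 M. \<forall>g \<in> L2 M. AE x in M. A (\<lambda>y. f y + g y) x = A f x + A g x) \<and>
     (\<forall>c. \<forall>f \<in> L2 M. AE x in M. A (\<lambda>y. c * f y) x = c * A f x)"

text \<open>
  By the norm bound (respectively by sequential compactness, applied to multiples of a null
  function), operators satisfying the next two predicates respect equality almost everywhere,
  so they do act on \<open>L\<^sup>2\<close> classes.
\<close>

definition bounded_L2 :: "'a measure \<Rightarrow> (('a \<Rightarrow> complex) \<Rightarrow> ('a \<Rightarrow> complex)) \<Rightarrow> bool" where
  "bounded_L2 M A \<longleftrightarrow>
     linear_L2 M A \<and> (\<exists>B. \<forall>f \<in> L2 M. norm_L2 M (A f) \<le> B * norm_L2 M f)"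

definition compact_L2 :: "'a measure \<Rightarrow> (('a \<Rightarrow> complex) \<Rightarrow> ('a \<Rightarrow> complex)) \<Rightarrow> bool" where
  "compact_L2 M A \<longleftrightarrow>
     linear_L2 M A \<and>
     (\<forall>F :: nat \<Rightarrow> 'a \<Rightarrow> complex. \<forall>B.
        (\<forall>n. F n \<in> L2 M \<and> norm_L2 M (F n) \<le> B) \<longrightarrow>
        (\<exists>g \<in> L2 M. \<exists>s :: nat \<Rightarrow> nat. strict_mono s \<and>
           (\<lambda>n. norm_L2 M (\<lambda>x. A (F (s n)) x - g x)) \<longlonglongrightarrow> 0))"

text \<open>A real-valued supremum, so only meaningful together with \<^const>\<open>bounded_L2\<close>.\<close>

definition op_norm_L2 :: "'a measure \<Rightarrow> (('a \<Rightarrow> complex) \<Rightarrow> ('a \<Rightarrow> complex)) \<Rightarrow> real" where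
  "op_norm_L2 M A = Sup {norm_L2 M (A f) | f. f \<in> L2 M \<and> norm_L2 M f \<le> 1}"

definition spectrum_L2 :: "'a measure \<Rightarrow> (('a \<Rightarrow> complex) \<Rightarrow> ('a \<Rightarrow> complex)) \<Rightarrow> complex set" where
  "spectrum_L2 M A = {z. \<not> (\<exists>S. bounded_L2 M S \<and>
     (\<forall>f \<in> L2 M. (AE x in M. S (\<lambda>y. A f y - z * f y) x = f x) \<and>
                 (AE x in M. A (S f) x - z * S f x = f x)))}"

definition Sup_or_zero :: "real set \<Rightarrow> real" where
  "Sup_or_zero S = (if S = {} then 0 else Sup S)"

definition spectral_radius_L2 :: "'a measure \<Rightarrow> (('a \<Rightarrow> complex) \<Rightarrow> ('a \<Rightarrow> complex)) \<Rightarrow> real" where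
  "spectral_radius_L2 M A = Sup_or_zero {cmod z | z. z \<in> spectrum_L2 M A}"

definition second_modulus_L2 :: "'a measure \<Rightarrow> (('a \<Rightarrow> complex) \<Rightarrow> ('a \<Rightarrow> complex)) \<Rightarrow> real" where
  "second_modulus_L2 M A =
     Sup_or_zero {cmod z | z. z \<in> spectrum_L2 M A \<and> z \<noteq> of_real (spectral_radius_L2 M A)}"

definition eigenfunction_L2 ::
    "'a measure \<Rightarrow> (('a \<Rightarrow> complex) \<Rightarrow> ('a \<Rightarrow> complex)) \<Rightarrow> complex \<Rightarrow> ('a \<Rightarrow> complex) \<Rightarrow> bool" where
  "eigenfunction_L2 M A z f \<longleftrightarrow>
     f \<in> L2 M \<and> \<not> (AE x in M. f x = 0) \<and> (AE x in M. A f x = z * f x)"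

definition ae_positive :: "'a measure \<Rightarrow> ('a \<Rightarrow> complex) \<Rightarrow> bool" where
  "ae_positive M f \<longleftrightarrow> (AE x in M. Im (f x) = 0 \<and> 0 < Re (f x))"

text \<open>
  The integration is over the first argument of the kernel; the adjoint is the integral operator
  of the transposed kernel.  As the Bochner integral of a non-integrable function is \<open>0\<close>,
  \<open>L2_kernel\<close> records that the defining integrals exist almost everywhere.
\<close>

definition integral_op ::
    "'a measure \<Rightarrow> ('a \<Rightarrow> 'a \<Rightarrow> real) \<Rightarrow> ('a \<Rightarrow> complex) \<Rightarrow> ('a \<Rightarrow> complex)" where
  "integral_op M R f = (\<lambda>y. LINT x|M. of_real (R x y) * f x)"

definition adjoint_integral_op ::
    "'a measure \<Rightarrow> ('a \<Rightarrow> 'a \<Rightarrow> real) \<Rightarrow> ('a \<Rightarrow> complex) \<Rightarrow> ('a \<Rightarrow> complex)" where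
  "adjoint_integral_op M R f = (\<lambda>y. LINT x|M. of_real (R y x) * f x)"

definition L2_kernel :: "'a measure \<Rightarrow> ('a \<Rightarrow> 'a \<Rightarrow> real) \<Rightarrow> bool" where
  "L2_kernel M R \<longleftrightarrow>
     (\<forall>f \<in> L2 M. AE y in M. integrable M (\<lambda>x. complex_of_real (R x y) * f x))"

definition proj_P ::
    "'a measure \<Rightarrow> ('a \<Rightarrow> complex) \<Rightarrow> ('a \<Rightarrow> complex) \<Rightarrow> ('a \<Rightarrow> complex) \<Rightarrow> ('a \<Rightarrow> complex)" where
  "proj_P M v w f = (\<lambda>x. inner_L2 M f w * v x)"

definition proj_Q ::
    "'a measure \<Rightarrow> ('a \<Rightarrow> complex) \<Rightarrow> ('a \<Rightarrow> complex) \<Rightarrow> ('a \<Rightarrow> complex) \<Rightarrow> ('a \<Rightarrow> complex)" where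
  "proj_Q M v w f = (\<lambda>x. f x - inner_L2 M f w * v x)"

end

theory Submission
  imports Defs "HOL-Complex_Analysis.Cauchy_Integral_Formula"
begin

text \<open>
  \<open>Q\<close> projects along \<open>v\<close> onto the orthogonal complement of \<open>w\<close>, which \<open>T\<close> leaves invariant; this
  gives the decomposition of \<open>T\<^sup>k\<close>.  By the Fredholm alternative a nonzero spectral value \<open>z\<close> of
  the compact operator \<open>T Q\<close> has an eigenfunction \<open>f\<close>; it is orthogonal to \<open>w\<close>, hence satisfies
  \<open>T f = z f\<close>.  Positivity of the kernel excludes \<open>z = r\<close>, so \<open>\<bar>z\<bar> \<le> \<bar>\<lambda>\<^sub>2\<bar>\<close>.  The powers of \<open>T Q\<close> are
  then bounded by Cauchy's inequality for \<open>u \<mapsto> \<langle>(1 - u T Q)\<^sup>-\<^sup>1 f, g\<rangle>\<close> on a circle of radius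
  \<open>1 / (\<bar>\<lambda>\<^sub>2\<bar> + \<epsilon>)\<close>.

  Riesz' proof of the Fredholm alternative and the bound on the powers use no completeness, so
  they apply to \<open>L\<^sup>2\<close> as a seminormed space of representatives.
\<close>

section \<open>The seminormed space of square-integrable functions\<close>

text \<open>Submultiplicativity bounds the powers only by those of the norm of \<open>T Q\<close>,
  which can exceed \<open>|lambda2|\<close>; spectral information has to enter through the
  resolvent. The variable is \<open>u = 1 / z\<close>, so that the condition on the spectrum becomes
  invertibility of \<open>1 - u T Q\<close> on a disc around 0, and the powers of \<open>T Q\<close>
  are the Taylor coefficients there. Cauchy's inequality concerns scalar functions, hence the
  pairing with \<open>g\<close>; the choice \<open>g = (T Q)^k f\<close> turns the scalar bound back
  into a norm bound whose constant depends neither on \<open>k\<close> nor on \<open>f\<close>. The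
  loss \<epsilon> keeps the circle inside the domain of the resolvent.

  The value \<open>r\<close> is delicate: \<open>|lambda2|\<close> is a supremum over spectral
  values of \<open>T\<close> other than \<open>r\<close>, so it would not control a spectral value
  \<open>r\<close> of \<open>T Q\<close>. This is why spectral values are turned into
  eigenfunctions, to which positivity applies, before they are compared with the spectrum of
  \<open>T\<close>.\<close>

lemma borel_measurable_cnj [measurable (raw)]:
  "f \<in> borel_measurable M \<Longrightarrow> (\<lambda>x. cnj (f x)) \<in> borel_measurable M"
  by (rule borel_measurable_continuous_on[where f=cnj]) (auto intro: continuous_intros)

lemma L2_measurable [measurable_dest]: "f \<in> L2 M \<Longrightarrow> f \<in> borel_measurable M"
  by (simp add: L2_def)

lemma L2_integrable_square: "f \<in> L2 M \<Longrightarrow> integrable M (\<lambda>x. (cmod (f x))\<^sup>2)"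
  by (simp add: L2_def)

lemma L2_zero [simp]: "(\<lambda>x. 0) \<in> L2 M"
  by (simp add: L2_def)

lemma L2_mult_left [intro]: "f \<in> L2 M \<Longrightarrow> (\<lambda>x. c * f x) \<in> L2 M"
  by (auto simp: L2_def norm_mult power_mult_distrib)

lemma L2_add [intro]:
  assumes f: "f \<in> L2 M" and g: "g \<in> L2 M"
  shows "(\<lambda>x. f x + g x) \<in> L2 M"
proof -
  have "integrable M (\<lambda>x. (cmod (f x + g x))\<^sup>2)"
  proof (rule Bochner_Integration.integrable_bound)
    show "integrable M (\<lambda>x. 2 * (cmod (f x))\<^sup>2 + 2 * (cmod (g x))\<^sup>2)"
      using L2_integrable_square[OF f] L2_integrable_square[OF g] by simp
    show "(\<lambda>x. (cmod (f x + g x))\<^sup>2) \<in> borel_measurable M"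
      using f g by measurable
    have "(cmod (f x + g x))\<^sup>2 \<le> 2 * (cmod (f x))\<^sup>2 + 2 * (cmod (g x))\<^sup>2" for x
    proof -
      have "(cmod (f x + g x))\<^sup>2 \<le> (cmod (f x) + cmod (g x))\<^sup>2"
        by (intro power_mono norm_triangle_ineq) simp
      also have "\<dots> \<le> 2 * (cmod (f x))\<^sup>2 + 2 * (cmod (g x))\<^sup>2"
        using sum_squares_bound[of "cmod (f x)" "cmod (g x)"] by (simp add: power2_sum)
      finally show ?thesis .
    qed
    then show "AE x in M. norm ((cmod (f x + g x))\<^sup>2)
        \<le> norm (2 * (cmod (f x))\<^sup>2 + 2 * (cmod (g x))\<^sup>2)"
      by simp
  qed
  with f g show ?thesis by (auto simp: L2_def)
qed

lemma L2_diff [intro]: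
  assumes "f \<in> L2 M" "g \<in> L2 M"
  shows "(\<lambda>x. f x - g x) \<in> L2 M"
  using L2_add[OF assms(1) L2_mult_left[OF assms(2), of "-1"]] by simp

lemma L2_norm_fun: "f \<in> L2 M \<Longrightarrow> (\<lambda>x. complex_of_real (cmod (f x))) \<in> L2 M"
  by (auto simp: L2_def)

lemma norm_L2_nonneg [simp]: "0 \<le> norm_L2 M f"
  by (simp add: norm_L2_def)

lemma norm_L2_zero [simp]: "norm_L2 M (\<lambda>x. 0) = 0"
  by (simp add: norm_L2_def)

lemma norm_L2_square: "(norm_L2 M f)\<^sup>2 = (LINT x|M. (cmod (f x))\<^sup>2)"
  by (simp add: norm_L2_def)

lemma norm_L2_mult_left: "norm_L2 M (\<lambda>x. c * f x) = cmod c * norm_L2 M f"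
  by (simp add: norm_L2_def norm_mult power_mult_distrib real_sqrt_mult)

lemma norm_L2_minus_commute: "norm_L2 M (\<lambda>x. f x - g x) = norm_L2 M (\<lambda>x. g x - f x)"
  by (simp add: norm_L2_def norm_minus_commute)

lemma norm_L2_cong_AE:
  assumes "f \<in> L2 M" "g \<in> L2 M" "AE x in M. f x = g x"
  shows "norm_L2 M f = norm_L2 M g"
proof -
  have "(LINT x|M. (cmod (f x))\<^sup>2) = (LINT x|M. (cmod (g x))\<^sup>2)"
    using assms by (intro integral_cong_AE) auto
  then show ?thesis by (simp add: norm_L2_def)
qed

lemma norm_L2_eq_0_iff:
  assumes "f \<in> L2 M"
  shows "norm_L2 M f = 0 \<longleftrightarrow> (AE x in M. f x = 0)"
  using integral_nonneg_eq_0_iff_AE[OF L2_integrable_square[OF assms]]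
  by (simp add: norm_L2_def)

section \<open>The inner product and the seminorm inequalities\<close>

lemma integrable_mult_L2:
  assumes f: "f \<in> L2 M" and g: "g \<in> L2 M"
  shows "integrable M (\<lambda>x. f x * cnj (g x))"
proof (rule Bochner_Integration.integrable_bound)
  show "integrable M (\<lambda>x. (cmod (f x))\<^sup>2 + (cmod (g x))\<^sup>2)"
    using L2_integrable_square[OF f] L2_integrable_square[OF g] by simp
  show "(\<lambda>x. f x * cnj (g x)) \<in> borel_measurable M"
    using f g by measurable
  have "cmod (f x) * cmod (g x) \<le> (cmod (f x))\<^sup>2 + (cmod (g x))\<^sup>2" for x
    using sum_squares_bound[of "cmod (f x)" "cmod (g x)"]
      mult_nonneg_nonneg[OF norm_ge_zero norm_ge_zero, of "f x" "g x"] by linarith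
  then show "AE x in M. norm (f x * cnj (g x)) \<le> norm ((cmod (f x))\<^sup>2 + (cmod (g x))\<^sup>2)"
    by (simp add: norm_mult)
qed

text \<open>For nonzero norms \<open>a\<close>, \<open>b\<close> the weighted inequality
  \<open>2 |f| |g| <= (b/a) |f|^2 + (a/b) |g|^2\<close> is integrated; the weights make both terms
  on the right integrate to \<open>a b\<close>. They are meaningless if a norm vanishes, so those
  cases go through vanishing almost everywhere.\<close>

lemma inner_L2_Cauchy_Schwarz:
  assumes f: "f \<in> L2 M" and g: "g \<in> L2 M"
  shows "cmod (inner_L2 M f g) \<le> norm_L2 M f * norm_L2 M g"
proof -
  have int: "integrable M (\<lambda>x. cmod (f x) * cmod (g x))"
    using integrable_norm[OF integrable_mult_L2[OF f g]] by (simp add: norm_mult)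
  have le: "cmod (inner_L2 M f g) \<le> (LINT x|M. cmod (f x) * cmod (g x))"
    unfolding inner_L2_def
    using integral_norm_bound[of M "\<lambda>x. f x * cnj (g x)"] by (simp add: norm_mult)
  consider "norm_L2 M f = 0" | "norm_L2 M g = 0" | "norm_L2 M f > 0" "norm_L2 M g > 0"
    using norm_L2_nonneg[of M f] norm_L2_nonneg[of M g] by linarith
  then show ?thesis
  proof cases
    case 1
    then have "AE x in M. f x * cnj (g x) = 0" using norm_L2_eq_0_iff[OF f] by auto
    then have "inner_L2 M f g = 0"
      unfolding inner_L2_def by (rule integral_eq_zero_AE)
    with 1 show ?thesis by simp
  next
    case 2
    then have "AE x in M. f x * cnj (g x) = 0" using norm_L2_eq_0_iff[OF g] by auto
    then have "inner_L2 M f g = 0"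
      unfolding inner_L2_def by (rule integral_eq_zero_AE)
    with 2 show ?thesis by simp
  next
    case 3
    define a b where "a = norm_L2 M f" and "b = norm_L2 M g"
    have ab: "a > 0" "b > 0" using 3 by (simp_all add: a_def b_def)
    have "2 * (LINT x|M. cmod (f x) * cmod (g x))
        \<le> (LINT x|M. (b/a) * (cmod (f x))\<^sup>2 + (a/b) * (cmod (g x))\<^sup>2)"
      unfolding integral_mult_right_zero[symmetric]
    proof (intro integral_mono)
      fix x
      have "0 \<le> (b * cmod (f x) - a * cmod (g x))\<^sup>2 / (a * b)"
        using ab by simp
      also have "\<dots> = (b/a) * (cmod (f x))\<^sup>2 + (a/b) * (cmod (g x))\<^sup>2
          - 2 * (cmod (f x) * cmod (g x))"
        using ab by (simp add: field_simps power2_eq_square)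
      finally show "2 * (cmod (f x) * cmod (g x))
          \<le> (b/a) * (cmod (f x))\<^sup>2 + (a/b) * (cmod (g x))\<^sup>2" by simp
    qed (use int L2_integrable_square[OF f] L2_integrable_square[OF g] in auto)
    also have "\<dots> = (b/a) * a\<^sup>2 + (a/b) * b\<^sup>2"
      using L2_integrable_square[OF f] L2_integrable_square[OF g]
      by (simp add: a_def b_def norm_L2_square)
    also have "\<dots> = 2 * (a * b)"
      using ab by (simp add: field_simps power2_eq_square)
    finally show ?thesis using le by (simp add: a_def b_def)
  qed
qed

lemma inner_L2_self: "inner_L2 M f f = of_real ((norm_L2 M f)\<^sup>2)"
  unfolding inner_L2_def norm_L2_square
  by (simp add: complex_norm_square[symmetric] del: of_real_power flip: integral_complex_of_real)

lemma inner_L2_add_left: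
  assumes "f \<in> L2 M" "g \<in> L2 M" "h \<in> L2 M"
  shows "inner_L2 M (\<lambda>x. f x + g x) h = inner_L2 M f h + inner_L2 M g h"
  using integrable_mult_L2[of f M h] integrable_mult_L2[of g M h] assms
  by (simp add: inner_L2_def distrib_right)

lemma inner_L2_diff_left:
  assumes "f \<in> L2 M" "g \<in> L2 M" "h \<in> L2 M"
  shows "inner_L2 M (\<lambda>x. f x - g x) h = inner_L2 M f h - inner_L2 M g h"
  using integrable_mult_L2[of f M h] integrable_mult_L2[of g M h] assms
  by (simp add: inner_L2_def left_diff_distrib)

lemma inner_L2_mult_left: "inner_L2 M (\<lambda>x. c * f x) h = c * inner_L2 M f h"
  by (simp add: inner_L2_def mult.assoc)

lemma inner_L2_cong_AE:
  assumes "f \<in> L2 M" "g \<in> L2 M" "h \<in> L2 M" "AE x in M. f x = g x"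
  shows "inner_L2 M f h = inner_L2 M g h"
  unfolding inner_L2_def using assms by (intro integral_cong_AE) auto

lemma norm_L2_triangle:
  assumes f: "f \<in> L2 M" and g: "g \<in> L2 M"
  shows "norm_L2 M (\<lambda>x. f x + g x) \<le> norm_L2 M f + norm_L2 M g"
proof (rule power2_le_imp_le)
  have fg: "integrable M (\<lambda>x. Re (f x * cnj (g x)))"
    using integrable_mult_L2[OF f g] by (rule integrable_Re)
  have Re: "(LINT x|M. Re (f x * cnj (g x))) = Re (inner_L2 M f g)"
    unfolding inner_L2_def by (rule integral_Re[OF integrable_mult_L2[OF f g]])
  have "(cmod (f x + g x))\<^sup>2 = (cmod (f x))\<^sup>2 + 2 * Re (f x * cnj (g x)) + (cmod (g x))\<^sup>2" for x
    by (simp add: cmod_power2 power2_sum algebra_simps)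
  then have "(norm_L2 M (\<lambda>x. f x + g x))\<^sup>2
      = (LINT x|M. (cmod (f x))\<^sup>2 + 2 * Re (f x * cnj (g x)) + (cmod (g x))\<^sup>2)"
    unfolding norm_L2_square by presburger
  also have "\<dots> = (norm_L2 M f)\<^sup>2 + 2 * Re (inner_L2 M f g) + (norm_L2 M g)\<^sup>2"
    using L2_integrable_square[OF f] L2_integrable_square[OF g] fg
    unfolding norm_L2_square Re[symmetric]
    by (simp del: times_complex.sel complex_cnj_mult)
  also have "\<dots> \<le> (norm_L2 M f)\<^sup>2 + 2 * (norm_L2 M f * norm_L2 M g) + (norm_L2 M g)\<^sup>2"
    using inner_L2_Cauchy_Schwarz[OF f g] complex_Re_le_cmod[of "inner_L2 M f g"] by linarith
  also have "\<dots> = (norm_L2 M f + norm_L2 M g)\<^sup>2"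
    by (simp add: power2_sum)
  finally show "(norm_L2 M (\<lambda>x. f x + g x))\<^sup>2 \<le> (norm_L2 M f + norm_L2 M g)\<^sup>2" .
qed simp

lemma norm_L2_triangle_diff:
  assumes "f \<in> L2 M" "g \<in> L2 M"
  shows "norm_L2 M (\<lambda>x. f x - g x) \<le> norm_L2 M f + norm_L2 M g"
  using norm_L2_triangle[OF assms(1) L2_mult_left[OF assms(2), of "-1"]]
    norm_L2_mult_left[of M "-1" g] by simp

lemma norm_L2_diff_triangle:
  assumes "f \<in> L2 M" "g \<in> L2 M" "h \<in> L2 M"
  shows "norm_L2 M (\<lambda>x. f x - h x) \<le> norm_L2 M (\<lambda>x. f x - g x) + norm_L2 M (\<lambda>x. g x - h x)"
  using norm_L2_triangle[OF L2_diff[OF assms(1,2)] L2_diff[OF assms(2,3)]] by simp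

lemma norm_L2_diff_le:
  assumes "f \<in> L2 M" "g \<in> L2 M"
  shows "\<bar>norm_L2 M f - norm_L2 M g\<bar> \<le> norm_L2 M (\<lambda>x. f x - g x)"
  using norm_L2_triangle[OF L2_diff[OF assms] assms(2)]
    norm_L2_triangle[OF L2_diff[OF assms(2,1)] assms(1)]
    norm_L2_minus_commute[of M f g]
  by (simp add: abs_le_iff)

lemma L2_limit_unique:
  assumes F: "\<And>n. F n \<in> L2 M" and g: "g \<in> L2 M" and h: "h \<in> L2 M"
    and "(\<lambda>n. norm_L2 M (\<lambda>x. F n x - g x)) \<longlonglongrightarrow> 0"
    and "(\<lambda>n. norm_L2 M (\<lambda>x. F n x - h x)) \<longlonglongrightarrow> 0"
  shows "AE x in M. g x = h x"
proof -
  have "(\<lambda>n. norm_L2 M (\<lambda>x. F n x - g x) + norm_L2 M (\<lambda>x. F n x - h x)) \<longlonglongrightarrow> 0 + 0"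
    using assms(4,5) by (rule tendsto_add)
  moreover have "norm_L2 M (\<lambda>x. g x - h x)
      \<le> norm_L2 M (\<lambda>x. F n x - g x) + norm_L2 M (\<lambda>x. F n x - h x)" for n
    using norm_L2_diff_triangle[OF g F h, of n] norm_L2_minus_commute[of M g "F n"] by simp
  ultimately have "norm_L2 M (\<lambda>x. g x - h x) \<le> 0"
    by (intro LIMSEQ_le_const[where X="\<lambda>n. norm_L2 M (\<lambda>x. F n x - g x) + norm_L2 M (\<lambda>x. F n x - h x)"]) auto
  then have "norm_L2 M (\<lambda>x. g x - h x) = 0"
    using norm_L2_nonneg[of M "\<lambda>x. g x - h x"] by linarith
  then show ?thesis
    using norm_L2_eq_0_iff[OF L2_diff[OF g h]] by simp
qed

section \<open>Bounded and compact operators\<close>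

lemma linear_L2_closed: "linear_L2 M A \<Longrightarrow> f \<in> L2 M \<Longrightarrow> A f \<in> L2 M"
  by (simp add: linear_L2_def)

lemma linear_L2_add:
  "linear_L2 M A \<Longrightarrow> f \<in> L2 M \<Longrightarrow> g \<in> L2 M \<Longrightarrow> AE x in M. A (\<lambda>y. f y + g y) x = A f x + A g x"
  by (simp add: linear_L2_def)

lemma linear_L2_mult: "linear_L2 M A \<Longrightarrow> f \<in> L2 M \<Longrightarrow> AE x in M. A (\<lambda>y. c * f y) x = c * A f x"
  by (simp add: linear_L2_def)

lemma linear_L2_diff:
  assumes A: "linear_L2 M A" and f: "f \<in> L2 M" and g: "g \<in> L2 M"
  shows "AE x in M. A (\<lambda>y. f y - g y) x = A f x - A g x"
  using linear_L2_add[OF A f L2_mult_left[OF g, of "-1"]] linear_L2_mult[OF A g, of "-1"]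
  by eventually_elim simp

lemma bounded_L2_linear: "bounded_L2 M A \<Longrightarrow> linear_L2 M A"
  by (simp add: bounded_L2_def)

lemmas bounded_L2_closed = linear_L2_closed[OF bounded_L2_linear]

lemma bounded_L2_bound:
  assumes "bounded_L2 M A"
  obtains B where "B > 0" "\<And>f. f \<in> L2 M \<Longrightarrow> norm_L2 M (A f) \<le> B * norm_L2 M f"
proof -
  obtain B where B: "\<And>f. f \<in> L2 M \<Longrightarrow> norm_L2 M (A f) \<le> B * norm_L2 M f"
    using assms by (auto simp: bounded_L2_def)
  have "norm_L2 M (A f) \<le> (\<bar>B\<bar> + 1) * norm_L2 M f" if "f \<in> L2 M" for f
    using B[OF that] mult_right_mono[of B "\<bar>B\<bar> + 1" "norm_L2 M f"] by fastforce
  then show thesis by (intro that[of "\<bar>B\<bar> + 1"]) auto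
qed

text \<open>The norm bound sends \<open>f - g\<close>, of norm 0, to a function of norm 0. This is
  what licenses rewriting by an almost everywhere identity underneath an operator.\<close>

lemma bounded_L2_cong_AE:
  assumes A: "bounded_L2 M A" and f: "f \<in> L2 M" and g: "g \<in> L2 M" and eq: "AE x in M. f x = g x"
  shows "AE x in M. A f x = A g x"
proof -
  obtain B where B: "\<And>f. f \<in> L2 M \<Longrightarrow> norm_L2 M (A f) \<le> B * norm_L2 M f"
    using bounded_L2_bound[OF A] by blast
  have "norm_L2 M (\<lambda>x. f x - g x) = 0"
    using norm_L2_eq_0_iff[OF L2_diff[OF f g]] eq by simp
  then have "norm_L2 M (A (\<lambda>x. f x - g x)) = 0"
    using B[OF L2_diff[OF f g]] norm_L2_nonneg[of M "A (\<lambda>x. f x - g x)"] by simp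
  then have "AE x in M. A (\<lambda>x. f x - g x) x = 0"
    using norm_L2_eq_0_iff[OF bounded_L2_closed[OF A L2_diff[OF f g]]] by simp
  with linear_L2_diff[OF bounded_L2_linear[OF A] f g] show ?thesis
    by eventually_elim simp
qed

text \<open>Linearity of \<open>B\<close> holds only almost everywhere, so pushing it through
  \<open>A\<close> takes the congruence property of \<open>A\<close>, hence its boundedness.\<close>

lemma bounded_L2_comp:
  assumes A: "bounded_L2 M A" and B: "bounded_L2 M B"
  shows "bounded_L2 M (A \<circ> B)"
proof -
  note lA = bounded_L2_linear[OF A] and lB = bounded_L2_linear[OF B]
  obtain a where a: "a > 0" "\<And>f. f \<in> L2 M \<Longrightarrow> norm_L2 M (A f) \<le> a * norm_L2 M f"
    using bounded_L2_bound[OF A] by blast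
  obtain b where b: "b > 0" "\<And>f. f \<in> L2 M \<Longrightarrow> norm_L2 M (B f) \<le> b * norm_L2 M f"
    using bounded_L2_bound[OF B] by blast
  have cl: "\<And>f. f \<in> L2 M \<Longrightarrow> B f \<in> L2 M" "\<And>f. f \<in> L2 M \<Longrightarrow> A f \<in> L2 M"
    using lA lB by (auto simp: linear_L2_def)
  have 1: "AE x in M. A (B (\<lambda>y. f y + g y)) x = A (B f) x + A (B g) x"
    if f: "f \<in> L2 M" and g: "g \<in> L2 M" for f g
    using bounded_L2_cong_AE[OF A cl(1)[OF L2_add[OF f g]] L2_add[OF cl(1)[OF f] cl(1)[OF g]]
        linear_L2_add[OF lB f g]] linear_L2_add[OF lA cl(1)[OF f] cl(1)[OF g]]
    by eventually_elim simp
  have 2: "AE x in M. A (B (\<lambda>y. c * f y)) x = c * A (B f) x" if f: "f \<in> L2 M" for f c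
    using bounded_L2_cong_AE[OF A cl(1)[OF L2_mult_left[OF f]] L2_mult_left[OF cl(1)[OF f]]
        linear_L2_mult[OF lB f, of c]] linear_L2_mult[OF lA cl(1)[OF f], of c]
    by eventually_elim simp
  have 3: "norm_L2 M (A (B f)) \<le> (a * b) * norm_L2 M f" if "f \<in> L2 M" for f
    using order_trans[OF a(2)[OF cl(1)[OF that]] mult_left_mono[OF b(2)[OF that]]] a(1)
    by (simp add: mult.assoc)
  show ?thesis
    unfolding bounded_L2_def linear_L2_def comp_apply
    by (intro conjI ballI allI exI[of _ "a * b"] 1 2 3 cl)
qed

lemma bounded_L2_id: "bounded_L2 M id"
  by (auto simp: bounded_L2_def linear_L2_def intro!: exI[of _ 1])

lemma bounded_L2_funpow: "bounded_L2 M A \<Longrightarrow> bounded_L2 M (A ^^ k)"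
  by (induction k) (auto simp: bounded_L2_id bounded_L2_comp)

text \<open>One form for \<open>A - z\<close>, for \<open>Q = 1 - P\<close> and for scalar multiples
  of an inverse.\<close>

lemma bounded_L2_shift:
  assumes A: "bounded_L2 M A"
  shows "bounded_L2 M (\<lambda>f x. a * A f x + b * f x)"
proof -
  note lA = bounded_L2_linear[OF A]
  obtain B where B: "\<And>f. f \<in> L2 M \<Longrightarrow> norm_L2 M (A f) \<le> B * norm_L2 M f"
    using bounded_L2_bound[OF A] by blast
  have "norm_L2 M (\<lambda>x. a * A f x + b * f x) \<le> (cmod a * B + cmod b) * norm_L2 M f"
    if "f \<in> L2 M" for f
    using norm_L2_triangle[OF L2_mult_left[OF linear_L2_closed[OF lA that]] L2_mult_left[OF that], of a b]
      mult_left_mono[OF B[OF that], of "cmod a"]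
    by (simp add: norm_L2_mult_left algebra_simps)
  moreover have "AE x in M. a * A (\<lambda>y. f y + g y) x + b * (f x + g x)
      = (a * A f x + b * f x) + (a * A g x + b * g x)" if "f \<in> L2 M" "g \<in> L2 M" for f g
    using linear_L2_add[OF lA that] by eventually_elim (simp add: algebra_simps)
  moreover have "AE x in M. a * A (\<lambda>y. c * f y) x + b * (c * f x) = c * (a * A f x + b * f x)"
    if "f \<in> L2 M" for c f
    using linear_L2_mult[OF lA that, of c] by eventually_elim (simp add: algebra_simps)
  ultimately show ?thesis
    unfolding bounded_L2_def linear_L2_def
    by (auto intro!: L2_add L2_mult_left linear_L2_closed[OF lA])
qed

lemma compact_L2_subseq:
  assumes "compact_L2 M A" "\<And>n. F n \<in> L2 M" "\<And>n. norm_L2 M (F n) \<le> B"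
  obtains g s where "g \<in> L2 M" and "strict_mono (s :: nat \<Rightarrow> nat)"
    and "(\<lambda>n. norm_L2 M (\<lambda>x. A (F (s n)) x - g x)) \<longlonglongrightarrow> 0"
  using assms unfolding compact_L2_def by blast

text \<open>If \<open>A\<close> were unbounded, some \<open>F n\<close> in the unit ball would have
  image of norm above \<open>n\<close>; a subsequence of the images converges, so its norms are
  bounded, although they exceed \<open>s n\<close> and hence \<open>n\<close>.\<close>

lemma compact_imp_bounded_L2:
  assumes A: "compact_L2 M A"
  shows "bounded_L2 M A"
proof (rule ccontr)
  have lA: "linear_L2 M A" using A by (simp add: compact_L2_def)
  assume "\<not> bounded_L2 M A"
  then have unb: "\<exists>f\<in>L2 M. norm_L2 M (A f) > B * norm_L2 M f" for B
    using lA unfolding bounded_L2_def by (auto simp: not_le)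
  have "\<exists>h\<in>L2 M. norm_L2 M h \<le> 1 \<and> norm_L2 M (A h) > real n" for n
  proof -
    obtain f where f: "f \<in> L2 M" "norm_L2 M (A f) > real n * norm_L2 M f"
      using unb by blast
    have scale: "norm_L2 M (A (\<lambda>x. of_real c * f x)) = c * norm_L2 M (A f)" if "c \<ge> 0" for c
      using norm_L2_cong_AE[OF linear_L2_closed[OF lA L2_mult_left[OF f(1)]]
          L2_mult_left[OF linear_L2_closed[OF lA f(1)]] linear_L2_mult[OF lA f(1)], of "of_real c"] that
      by (simp add: norm_L2_mult_left)
    have pos: "norm_L2 M (A f) > 0"
      using f(2) by (smt (verit) mult_nonneg_nonneg norm_L2_nonneg of_nat_0_le_iff)
    \<comment> \<open>A null \<open>f\<close> with a non-null image is not yet excluded, since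
      congruence follows only from boundedness. Such an \<open>f\<close> cannot be normalised, but
      it stays in the unit ball under any scaling, so it is blown up until its image has norm
      \<open>n + 1\<close>.\<close>
    define c where "c = (if norm_L2 M f = 0 then (real n + 1) / norm_L2 M (A f) else 1 / norm_L2 M f)"
    have c: "c \<ge> 0" "c * norm_L2 M f \<le> 1" "c * norm_L2 M (A f) > real n"
      using f(2) pos norm_L2_nonneg[of M f]
      by (auto simp: c_def divide_simps less_le simp del: norm_L2_nonneg)
    show ?thesis
      using c scale[OF c(1)] f(1)
      by (intro bexI[of _ "\<lambda>x. of_real c * f x"]) (auto simp: norm_L2_mult_left)
  qed
  then obtain F where F: "\<And>n. F n \<in> L2 M" "\<And>n. norm_L2 M (F n) \<le> 1"
      "\<And>n. norm_L2 M (A (F n)) > real n"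
    by metis
  obtain g s where g: "g \<in> L2 M" and s: "strict_mono (s :: nat \<Rightarrow> nat)"
    and lim: "(\<lambda>n. norm_L2 M (\<lambda>x. A (F (s n)) x - g x)) \<longlonglongrightarrow> 0"
    using compact_L2_subseq[of M A F 1, OF A F(1) F(2)] .
  obtain K where K: "\<And>n. norm (norm_L2 M (\<lambda>x. A (F (s n)) x - g x)) \<le> K"
    using BseqE[OF convergent_imp_Bseq[OF convergentI[OF lim]]] by blast
  obtain n where n: "real n > K + norm_L2 M g" using reals_Archimedean2 by blast
  have "real n \<le> real (s n)" using s by (simp add: seq_suble)
  also have "\<dots> < norm_L2 M (A (F (s n)))" by (rule F)
  also have "\<dots> \<le> K + norm_L2 M g"
    using norm_L2_diff_le[OF linear_L2_closed[OF lA F(1)] g, of "s n"] K[of n] unfolding real_norm_def by linarith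
  finally show False using n by simp
qed

lemma compact_L2_comp_bounded:
  assumes A: "compact_L2 M A" and B: "bounded_L2 M B"
  shows "compact_L2 M (A \<circ> B)"
proof -
  have lin: "linear_L2 M (A \<circ> B)"
    using bounded_L2_comp[OF compact_imp_bounded_L2[OF A] B] by (rule bounded_L2_linear)
  obtain b where b: "b > 0" "\<And>f. f \<in> L2 M \<Longrightarrow> norm_L2 M (B f) \<le> b * norm_L2 M f"
    using bounded_L2_bound[OF B] by blast
  have ex: "\<exists>g\<in>L2 M. \<exists>s :: nat \<Rightarrow> nat. strict_mono s \<and>
      (\<lambda>n. norm_L2 M (\<lambda>x. (A \<circ> B) (F (s n)) x - g x)) \<longlonglongrightarrow> 0"
    if F: "\<forall>n. F n \<in> L2 M \<and> norm_L2 M (F n) \<le> C" for F C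
  proof -
    have bd: "norm_L2 M (B (F n)) \<le> b * C" for n
      using b(2)[of "F n"] mult_left_mono[of "norm_L2 M (F n)" C b] F b(1)
      by (meson less_imp_le order_trans)
    have in_L2: "B (F n) \<in> L2 M" for n using F bounded_L2_closed[OF B] by blast
    obtain g s where "g \<in> L2 M" "strict_mono (s :: nat \<Rightarrow> nat)"
        "(\<lambda>n. norm_L2 M (\<lambda>x. A (B (F (s n))) x - g x)) \<longlonglongrightarrow> 0"
      using compact_L2_subseq[of M A "\<lambda>n. B (F n)" "b * C", OF A in_L2 bd] .
    then show ?thesis unfolding comp_apply by (intro bexI exI conjI)
  qed
  show ?thesis
    unfolding compact_L2_def by (intro conjI allI impI lin) (erule ex)
qed

lemma tendsto_zero_leI:
  fixes f g :: "nat \<Rightarrow> real"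
  assumes "g \<longlonglongrightarrow> 0" "\<And>n. 0 \<le> f n" "\<And>n. f n \<le> g n"
  shows "f \<longlonglongrightarrow> 0"
  by (rule tendsto_sandwich[OF _ _ tendsto_const assms(1)]) (simp_all add: assms)

lemma tendsto_zero_inverse_SucI:
  fixes f :: "nat \<Rightarrow> real"
  assumes "\<And>n. 0 \<le> f n" "\<And>n. f n \<le> 1 / real (Suc n)"
  shows "f \<longlonglongrightarrow> 0"
  using assms by (intro tendsto_zero_leI[OF LIMSEQ_inverse_real_of_nat]) (simp_all add: inverse_eq_divide)

lemma bounded_L2_minus_scalar:
  "bounded_L2 M A \<Longrightarrow> bounded_L2 M (\<lambda>f x. A f x - z * f x)"
  using bounded_L2_shift[of M A 1 "- z"] by simp

lemma bounded_L2_norm_diff: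
  assumes A: "bounded_L2 M A" and B: "\<And>f. f \<in> L2 M \<Longrightarrow> norm_L2 M (A f) \<le> B * norm_L2 M f"
    and f: "f \<in> L2 M" and g: "g \<in> L2 M"
  shows "norm_L2 M (\<lambda>x. A f x - A g x) \<le> B * norm_L2 M (\<lambda>x. f x - g x)"
  using norm_L2_cong_AE[OF bounded_L2_closed[OF A L2_diff[OF f g]]
      L2_diff[OF bounded_L2_closed[OF A f] bounded_L2_closed[OF A g]]
      linear_L2_diff[OF bounded_L2_linear[OF A] f g]] B[OF L2_diff[OF f g]]
  by linarith

lemma bounded_L2_tendsto:
  assumes A: "bounded_L2 M A" and F: "\<And>n. F n \<in> L2 M" and f: "f \<in> L2 M"
    and lim: "(\<lambda>n. norm_L2 M (\<lambda>x. F n x - f x)) \<longlonglongrightarrow> 0"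
  shows "(\<lambda>n. norm_L2 M (\<lambda>x. A (F n) x - A f x)) \<longlonglongrightarrow> 0"
proof -
  obtain B where B: "B > 0" "\<And>f. f \<in> L2 M \<Longrightarrow> norm_L2 M (A f) \<le> B * norm_L2 M f"
    using bounded_L2_bound[OF A] by blast
  show ?thesis
    by (rule tendsto_zero_leI[OF tendsto_mult_right_zero[OF lim] norm_L2_nonneg
        bounded_L2_norm_diff[OF A B(2) F f]])
qed

section \<open>The Fredholm alternative\<close>

text \<open>In \<open>z F n = A (F n) - (A - z) (F n)\<close> the first term converges along a
  subsequence by compactness and the second by assumption. Division by \<open>z\<close> therefore
  exhibits the limit of \<open>F\<close> explicitly as \<open>(g - h) / z\<close>, and continuity
  makes it a preimage of \<open>h\<close>.\<close>

lemma compact_L2_minus_scalar_subseq: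
  assumes A: "compact_L2 M A" and z: "z \<noteq> 0"
    and F: "\<And>n. F n \<in> L2 M" and bd: "\<And>n. norm_L2 M (F n) \<le> B" and h: "h \<in> L2 M"
    and lim: "(\<lambda>n. norm_L2 M (\<lambda>x. A (F n) x - z * F n x - h x)) \<longlonglongrightarrow> 0"
  obtains f s where "f \<in> L2 M" and "strict_mono (s :: nat \<Rightarrow> nat)"
    and "(\<lambda>n. norm_L2 M (\<lambda>x. F (s n) x - f x)) \<longlonglongrightarrow> 0"
    and "AE x in M. A f x - z * f x = h x"
proof -
  note bA = compact_imp_bounded_L2[OF A]
  note bS = bounded_L2_minus_scalar[OF bA, of z]
  note cl = bounded_L2_closed[OF bA] and clS = bounded_L2_closed[OF bS]
  obtain g s where g: "g \<in> L2 M" and s: "strict_mono (s :: nat \<Rightarrow> nat)"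
    and lim2: "(\<lambda>n. norm_L2 M (\<lambda>x. A (F (s n)) x - g x)) \<longlonglongrightarrow> 0"
    using compact_L2_subseq[of M A F B, OF A F bd] .
  define f where "f = (\<lambda>x. (1 / z) * (g x - h x))"
  have f: "f \<in> L2 M" unfolding f_def by (intro L2_mult_left L2_diff g h)
  have lim1: "(\<lambda>n. norm_L2 M (\<lambda>x. A (F (s n)) x - z * F (s n) x - h x)) \<longlonglongrightarrow> 0"
    using LIMSEQ_subseq_LIMSEQ[OF lim s] by (simp add: comp_def)
  have le: "norm_L2 M (\<lambda>x. F (s n) x - f x) \<le> (1 / cmod z) * (norm_L2 M (\<lambda>x. A (F (s n)) x - g x)
      + norm_L2 M (\<lambda>x. A (F (s n)) x - z * F (s n) x - h x))" for n
  proof -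
    have "F (s n) x - f x = (1 / z) * ((A (F (s n)) x - g x) - (A (F (s n)) x - z * F (s n) x - h x))" for x
      using z by (simp add: f_def field_simps)
    then have "norm_L2 M (\<lambda>x. F (s n) x - f x) = (1 / cmod z) *
       norm_L2 M (\<lambda>x. (A (F (s n)) x - g x) - (A (F (s n)) x - z * F (s n) x - h x))"
      using norm_L2_mult_left[of M "1 / z"] by (simp add: norm_divide)
    also have "\<dots> \<le> (1 / cmod z) * (norm_L2 M (\<lambda>x. A (F (s n)) x - g x)
        + norm_L2 M (\<lambda>x. A (F (s n)) x - z * F (s n) x - h x))"
      by (intro mult_left_mono norm_L2_triangle_diff L2_diff cl F g clS h L2_mult_left) simp
    finally show ?thesis .
  qed
  have lim3: "(\<lambda>n. norm_L2 M (\<lambda>x. F (s n) x - f x)) \<longlonglongrightarrow> 0"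
    by (rule tendsto_zero_leI[OF tendsto_mult_right_zero[OF tendsto_add_zero[OF lim2 lim1]]
      norm_L2_nonneg le])
  have "(\<lambda>n. norm_L2 M (\<lambda>x. (A (F (s n)) x - z * F (s n) x) - (A f x - z * f x))) \<longlonglongrightarrow> 0"
    using bounded_L2_tendsto[OF bS F f lim3] .
  then have "AE x in M. A f x - z * f x = h x"
    using L2_limit_unique[OF clS[OF F] clS[OF f] h _ lim1] by blast
  with f s lim3 show thesis by (rule that)
qed

text \<open>Otherwise there are unit vectors with \<open>(A - z) (F n)\<close> tending to 0; a
  subsequential limit lies in the kernel and is null by injectivity, yet it is a limit of unit
  vectors.\<close>

lemma compact_L2_minus_scalar_bounded_below:
  assumes A: "compact_L2 M A" and z: "z \<noteq> 0"
    and inj: "\<And>f. f \<in> L2 M \<Longrightarrow> AE x in M. A f x = z * f x \<Longrightarrow> AE x in M. f x = 0"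
  obtains c where "c > 0" and "\<And>f. f \<in> L2 M \<Longrightarrow> c * norm_L2 M f \<le> norm_L2 M (\<lambda>x. A f x - z * f x)"
proof -
  note bS = bounded_L2_minus_scalar[OF compact_imp_bounded_L2[OF A], of z]
  note clS = bounded_L2_closed[OF bS]
  have "\<exists>c>0. \<forall>f\<in>L2 M. c * norm_L2 M f \<le> norm_L2 M (\<lambda>x. A f x - z * f x)"
  proof (rule ccontr)
    assume neg: "\<not> ?thesis"
    have "\<exists>f\<in>L2 M. norm_L2 M f = 1 \<and> norm_L2 M (\<lambda>x. A f x - z * f x) \<le> 1 / real (Suc n)" for n
    proof -
      obtain f where f: "f \<in> L2 M"
        and less: "norm_L2 M (\<lambda>x. A f x - z * f x) < 1 / real (Suc n) * norm_L2 M f"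
        using neg[simplified, rule_format, of "1 / real (Suc n)"] by (auto simp: not_le)
      then have "0 < 1 / real (Suc n) * norm_L2 M f"
        using norm_L2_nonneg[of M "\<lambda>x. A f x - z * f x"] by linarith
      then have pos: "norm_L2 M f > 0" by (simp add: zero_less_divide_iff)
      let ?c = "complex_of_real (1 / norm_L2 M f)"
      let ?f = "\<lambda>x. ?c * f x"
      have "norm_L2 M (\<lambda>x. A ?f x - z * ?f x) = norm_L2 M (\<lambda>x. ?c * (A f x - z * f x))"
        by (intro norm_L2_cong_AE[OF clS[OF L2_mult_left[OF f]] L2_mult_left[OF clS[OF f]]]
            linear_L2_mult[OF bounded_L2_linear[OF bS] f])
      also have "\<dots> \<le> 1 / real (Suc n)"
        unfolding norm_L2_mult_left norm_of_real using less pos by (simp add: field_simps)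
      finally have "norm_L2 M (\<lambda>x. A ?f x - z * ?f x) \<le> 1 / real (Suc n)" .
      moreover have "norm_L2 M ?f = 1"
        unfolding norm_L2_mult_left norm_of_real using pos by simp
      ultimately show ?thesis by (intro bexI[of _ ?f] conjI L2_mult_left f)
    qed
    then obtain F where F: "\<And>n. F n \<in> L2 M" and one: "\<And>n. norm_L2 M (F n) = 1"
      and small: "\<And>n. norm_L2 M (\<lambda>x. A (F n) x - z * F n x) \<le> 1 / real (Suc n)"
      by metis
    have "(\<lambda>n. norm_L2 M (\<lambda>x. A (F n) x - z * F n x - 0)) \<longlonglongrightarrow> 0"
      using small by (intro tendsto_zero_inverse_SucI) simp_all
    then obtain f s where f: "f \<in> L2 M" and lim: "(\<lambda>n. norm_L2 M (\<lambda>x. F (s n) x - f x)) \<longlonglongrightarrow> 0"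
      and eq: "AE x in M. A f x - z * f x = 0"
      using compact_L2_minus_scalar_subseq[of M A z F 1 "\<lambda>x. 0", OF A z F eq_refl[OF one] L2_zero] by blast
    have "norm_L2 M f = 0"
      using inj[OF f] eq norm_L2_eq_0_iff[OF f] by simp
    then have "1 \<le> norm_L2 M (\<lambda>x. F (s n) x - f x)" for n
      using norm_L2_diff_le[OF F f, of "s n"] one[of "s n"] by simp
    then have "1 \<le> (0::real)"
      by (intro LIMSEQ_le_const[OF lim]) auto
    then show False by simp
  qed
  with that show thesis by blast
qed

section \<open>Closed subspaces, Riesz' lemma and surjectivity\<close>

definition closed_subspace_L2 :: "'a measure \<Rightarrow> ('a \<Rightarrow> complex) set \<Rightarrow> bool" where
  "closed_subspace_L2 M V \<longleftrightarrow> V \<subseteq> L2 M \<and> (\<lambda>x. 0) \<in> V \<and>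
     (\<forall>f\<in>V. \<forall>g\<in>V. (\<lambda>x. f x + g x) \<in> V) \<and> (\<forall>c. \<forall>f\<in>V. (\<lambda>x. c * f x) \<in> V) \<and>
     (\<forall>F g. (\<forall>n. F n \<in> V) \<and> g \<in> L2 M \<and> (\<lambda>n. norm_L2 M (\<lambda>x. F n x - g x)) \<longlonglongrightarrow> 0 \<longrightarrow> g \<in> V)"

lemma closed_subspace_L2D:
  assumes "closed_subspace_L2 M V"
  shows "\<And>f. f \<in> V \<Longrightarrow> f \<in> L2 M" and "(\<lambda>x. 0) \<in> V"
    and "\<And>f g. f \<in> V \<Longrightarrow> g \<in> V \<Longrightarrow> (\<lambda>x. f x + g x) \<in> V"
    and "\<And>c f. f \<in> V \<Longrightarrow> (\<lambda>x. c * f x) \<in> V"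
    and "\<And>F g. (\<And>n. F n \<in> V) \<Longrightarrow> g \<in> L2 M \<Longrightarrow> (\<lambda>n. norm_L2 M (\<lambda>x. F n x - g x)) \<longlonglongrightarrow> 0 \<Longrightarrow> g \<in> V"
  using assms unfolding closed_subspace_L2_def by blast+

lemma closed_subspace_L2_diff:
  assumes "closed_subspace_L2 M V" "f \<in> V" "g \<in> V"
  shows "(\<lambda>x. f x - g x) \<in> V"
  using closed_subspace_L2D(3)[OF assms(1,2) closed_subspace_L2D(4)[OF assms(1,3), of "-1"]] by simp

text \<open>A constant sequence converges in the seminorm to every representative of its class, so
  closedness already makes \<open>V\<close> a union of classes.\<close>

lemma closed_subspace_L2_cong_AE:
  assumes V: "closed_subspace_L2 M V" and f: "f \<in> V" and g: "g \<in> L2 M" and "AE x in M. f x = g x"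
  shows "g \<in> V"
proof -
  have "norm_L2 M (\<lambda>x. f x - g x) = 0"
    using norm_L2_eq_0_iff[OF L2_diff[OF closed_subspace_L2D(1)[OF V f] g]] assms(4) by simp
  then show ?thesis using closed_subspace_L2D(5)[OF V, of "\<lambda>n. f" g] f g by simp
qed

text \<open>The distance \<open>d\<close> from \<open>f\<close> to \<open>V\<close> is positive
  because \<open>V\<close> is closed. A \<open>v\<close> in \<open>V\<close> at distance
  \<open>m < 2 d\<close> from \<open>f\<close> is used, and \<open>f - v\<close> is divided by
  \<open>m\<close>; moving by \<open>u\<close> in \<open>V\<close> amounts to replacing
  \<open>v\<close> by \<open>v + m u\<close>, still at distance at least \<open>d\<close>, and
  \<open>d / m > 1/2\<close>.\<close>

lemma Riesz_lemma_L2: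
  assumes V: "closed_subspace_L2 M V" and f: "f \<in> L2 M" and "f \<notin> V"
  obtains v c where "v \<in> V" and "norm_L2 M (\<lambda>x. c * (f x - v x)) = 1"
    and "\<And>u. u \<in> V \<Longrightarrow> 1 / 2 \<le> norm_L2 M (\<lambda>x. c * (f x - v x) - u x)"
proof -
  note VD = closed_subspace_L2D[OF V]
  define D where "D = (\<lambda>v. norm_L2 M (\<lambda>x. f x - v x)) ` V"
  define d where "d = Inf D"
  have D: "D \<noteq> {}" "bdd_below D"
    using VD(2) by (auto simp: D_def intro!: bdd_belowI[of _ 0])
  have d_le: "d \<le> norm_L2 M (\<lambda>x. f x - v x)" if "v \<in> V" for v
    unfolding d_def using that D(2) by (intro cInf_lower) (auto simp: D_def)
  have "d > 0"
  proof (rule ccontr)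
    assume "\<not> d > 0"
    then have "Inf D < 1 / real (Suc n)" for n
      unfolding d_def by (smt (verit) divide_pos_pos of_nat_0_less_iff zero_less_Suc)
    then have "\<exists>v\<in>V. norm_L2 M (\<lambda>x. v x - f x) < 1 / real (Suc n)" for n
      using cInf_lessD[OF D(1)] unfolding norm_L2_minus_commute[of M _ f] by (auto simp: D_def)
    then obtain v where v: "\<And>n. v n \<in> V" "\<And>n. norm_L2 M (\<lambda>x. v n x - f x) < 1 / real (Suc n)"
      by metis
    have "(\<lambda>n. norm_L2 M (\<lambda>x. v n x - f x)) \<longlonglongrightarrow> 0"
      by (intro tendsto_zero_inverse_SucI norm_L2_nonneg less_imp_le v(2))
    then have "f \<in> V" using VD(5)[of v f] v(1) f by blast
    with assms show False by blast
  qed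
  then have "Inf D < 2 * d" by (simp add: d_def)
  then obtain v where v: "v \<in> V" "norm_L2 M (\<lambda>x. f x - v x) < 2 * d"
    using cInf_lessD[OF D(1)] by (auto simp: D_def)
  define m where "m = norm_L2 M (\<lambda>x. f x - v x)"
  have m: "m > 0" "m < 2 * d" using d_le[OF v(1)] v(2) \<open>d > 0\<close> by (auto simp: m_def)
  show thesis
  proof (rule that[OF v(1), of "of_real (1 / m)"])
    show "norm_L2 M (\<lambda>x. complex_of_real (1 / m) * (f x - v x)) = 1"
      unfolding norm_L2_mult_left using m by (simp add: m_def norm_divide)
  next
    fix u assume u: "u \<in> V"
    have "1 / 2 \<le> (1 / m) * d" using m by (simp add: field_simps)
    also have "\<dots> \<le> (1 / m) * norm_L2 M (\<lambda>x. f x - (v x + of_real m * u x))"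
      using m d_le[OF VD(3)[OF v(1) VD(4)[OF u]]] by (intro mult_left_mono) auto
    also have "\<dots> = norm_L2 M (\<lambda>x. of_real (1 / m) * (f x - (v x + of_real m * u x)))"
      unfolding norm_L2_mult_left using m by (simp add: norm_divide)
    also have "\<dots> = norm_L2 M (\<lambda>x. of_real (1 / m) * (f x - v x) - u x)"
      using m by (intro arg_cong[of _ _ "norm_L2 M"] ext) (simp add: field_simps)
    finally show "1 / 2 \<le> norm_L2 M (\<lambda>x. complex_of_real (1 / m) * (f x - v x) - u x)" .
  qed
qed

text \<open>All representatives of image classes are included; the plain image under
  \<open>A\<close> need not be saturated under almost everywhere equality and could then not be a
  closed subspace.\<close>

definition image_L2 :: "'a measure \<Rightarrow> (('a \<Rightarrow> complex) \<Rightarrow> ('a \<Rightarrow> complex)) \<Rightarrow>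
    ('a \<Rightarrow> complex) set \<Rightarrow> ('a \<Rightarrow> complex) set" where
  "image_L2 M A V = {h \<in> L2 M. \<exists>f\<in>V. AE x in M. A f x = h x}"

text \<open>The lower bound \<open>c\<close> makes preimages of a convergent sequence bounded, so
  compactness gives a convergent subsequence of preimages; its limit lies in \<open>V\<close> and is
  mapped to the limit of the images.\<close>

lemma closed_subspace_image_L2:
  assumes A: "compact_L2 M A" and z: "z \<noteq> 0" and V: "closed_subspace_L2 M V"
    and c: "c > 0" "\<And>f. f \<in> L2 M \<Longrightarrow> c * norm_L2 M f \<le> norm_L2 M (\<lambda>x. A f x - z * f x)"
  shows "closed_subspace_L2 M (image_L2 M (\<lambda>f x. A f x - z * f x) V)" (is "closed_subspace_L2 M (image_L2 M ?S V)")
proof -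
  note VD = closed_subspace_L2D[OF V]
  have S: "bounded_L2 M ?S"
    by (rule bounded_L2_minus_scalar[OF compact_imp_bounded_L2[OF A]])
  note lS = bounded_L2_linear[OF S]
  have zero: "(\<lambda>x. 0) \<in> image_L2 M ?S V"
    using linear_L2_mult[OF lS VD(1)[OF VD(2)], of 0] VD(2)
    by (auto simp: image_L2_def intro!: bexI[of _ "\<lambda>x. 0"])
  have add: "(\<lambda>x. h x + k x) \<in> image_L2 M ?S V"
    if hk: "h \<in> image_L2 M ?S V" "k \<in> image_L2 M ?S V" for h k
  proof -
    obtain f g where fg: "f \<in> V" "g \<in> V" "AE x in M. ?S f x = h x" "AE x in M. ?S g x = k x"
      using hk unfolding image_L2_def by blast
    have "AE x in M. ?S (\<lambda>y. f y + g y) x = h x + k x"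
      using linear_L2_add[OF lS VD(1)[OF fg(1)] VD(1)[OF fg(2)]] fg(3,4)
      by eventually_elim simp
    moreover have "(\<lambda>x. h x + k x) \<in> L2 M" using that by (auto simp: image_L2_def)
    ultimately show ?thesis using VD(3)[OF fg(1,2)] unfolding image_L2_def by blast
  qed
  have mult: "(\<lambda>x. a * h x) \<in> image_L2 M ?S V" if h: "h \<in> image_L2 M ?S V" for h a
  proof -
    obtain f where f: "f \<in> V" "AE x in M. ?S f x = h x"
      using h unfolding image_L2_def by blast
    have "AE x in M. ?S (\<lambda>y. a * f y) x = a * h x"
      using linear_L2_mult[OF lS VD(1)[OF f(1)], of a] f(2) by eventually_elim simp
    moreover have "(\<lambda>x. a * h x) \<in> L2 M" using that by (auto simp: image_L2_def)
    ultimately show ?thesis using VD(4)[OF f(1)] unfolding image_L2_def by blast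
  qed
  have closed: "g \<in> image_L2 M ?S V"
    if H: "\<And>n. H n \<in> image_L2 M ?S V" and g: "g \<in> L2 M"
      and lim: "(\<lambda>n. norm_L2 M (\<lambda>x. H n x - g x)) \<longlonglongrightarrow> 0" for H g
  proof -
    have HL: "H n \<in> L2 M" for n using H[of n] by (simp add: image_L2_def)
    have "\<exists>f\<in>V. AE x in M. ?S f x = H n x" for n using H[of n] by (simp add: image_L2_def)
    then obtain F where F: "\<And>n. F n \<in> V" "\<And>n. AE x in M. ?S (F n) x = H n x" by metis
    note FL = VD(1)[OF F(1)] and SF = bounded_L2_closed[OF S VD(1)[OF F(1)]]
    have "norm_L2 M (\<lambda>x. ?S (F n) x - g x) = norm_L2 M (\<lambda>x. H n x - g x)" for n
      using F(2)[of n] by (intro norm_L2_cong_AE L2_diff SF g HL) auto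
    with lim have lim': "(\<lambda>n. norm_L2 M (\<lambda>x. ?S (F n) x - g x)) \<longlonglongrightarrow> 0" by simp
    obtain K where K: "\<And>n. norm (norm_L2 M (\<lambda>x. ?S (F n) x - g x)) \<le> K"
      using BseqE[OF convergent_imp_Bseq[OF convergentI[OF lim']]] by blast
    have bd: "norm_L2 M (F n) \<le> (K + norm_L2 M g) / c" for n
    proof -
      have "c * norm_L2 M (F n) \<le> K + norm_L2 M g"
        using c(2)[OF FL, of n] norm_L2_diff_le[OF SF g, of n] K[of n] unfolding real_norm_def by linarith
      then show ?thesis using c(1) by (simp add: field_simps)
    qed
    obtain f s where f: "f \<in> L2 M" and "strict_mono (s :: nat \<Rightarrow> nat)"
      and "(\<lambda>n. norm_L2 M (\<lambda>x. F (s n) x - f x)) \<longlonglongrightarrow> 0" and eq: "AE x in M. ?S f x = g x"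
      using compact_L2_minus_scalar_subseq[of M A z F _ g, OF A z FL bd g lim'] .
    then have "f \<in> V" using VD(5)[of "\<lambda>n. F (s n)" f] F(1) by blast
    with eq g show ?thesis by (auto simp: image_L2_def)
  qed
  show ?thesis
    unfolding closed_subspace_L2_def
  proof (intro conjI ballI allI impI)
    show "image_L2 M ?S V \<subseteq> L2 M" by (auto simp: image_L2_def)
    fix F g
    assume "(\<forall>n. F n \<in> image_L2 M ?S V) \<and> g \<in> L2 M \<and> (\<lambda>n. norm_L2 M (\<lambda>x. F n x - g x)) \<longlonglongrightarrow> 0"
    then show "g \<in> image_L2 M ?S V" by (elim conjE) (rule closed[of F g], simp_all)
  qed (rule zero add mult; assumption)+
qed

lemma closed_subspace_L2_whole: "closed_subspace_L2 M (L2 M)"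
  by (auto simp: closed_subspace_L2_def)

text \<open>
  If the range of \<open>S = A - z\<close> were proper, the ranges of the powers of \<open>S\<close> would decrease strictly;
  Riesz' lemma then picks unit vectors in them whose images under \<open>A\<close> stay \<open>\<bar>z\<bar>/2\<close> apart.
\<close>
lemma compact_L2_minus_scalar_surj:
  assumes A: "compact_L2 M A" and z: "z \<noteq> 0"
    and inj: "\<And>f. f \<in> L2 M \<Longrightarrow> AE x in M. A f x = z * f x \<Longrightarrow> AE x in M. f x = 0"
    and h: "h \<in> L2 M"
  shows "\<exists>f\<in>L2 M. AE x in M. A f x - z * f x = h x"
proof (rule ccontr)
  assume neg: "\<not> ?thesis"
  obtain c where c: "c > 0" "\<And>f. f \<in> L2 M \<Longrightarrow> c * norm_L2 M f \<le> norm_L2 M (\<lambda>x. A f x - z * f x)"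
    using compact_L2_minus_scalar_bounded_below[OF A z inj] by blast
  define S where "S = (\<lambda>f x. A f x - z * f x)"
  note bA = compact_imp_bounded_L2[OF A]
  have S: "bounded_L2 M S" unfolding S_def by (rule bounded_L2_minus_scalar[OF bA])
  note lS = bounded_L2_linear[OF S] and clS = bounded_L2_closed[OF S]
  define V where "V = (\<lambda>n. (image_L2 M S ^^ n) (L2 M))"
  have V0: "V 0 = L2 M" and VSuc: "V (Suc n) = image_L2 M S (V n)" for n
    by (simp_all add: V_def)
  have V: "closed_subspace_L2 M (V n)" for n
  proof (induction n)
    case 0 show ?case unfolding V0 by (rule closed_subspace_L2_whole)
  next
    case (Suc n) show ?case
      unfolding VSuc S_def by (rule closed_subspace_image_L2[OF A z Suc c])
  qed
  note VL = closed_subspace_L2D(1)[OF V]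
  have dec1: "V (Suc n) \<subseteq> V n" for n
  proof (induction n)
    case 0 show ?case using VL[of _ 1] by (auto simp: V0)
  next
    case (Suc n) then show ?case unfolding VSuc[of "Suc n"] VSuc[of n] by (auto simp: image_L2_def)
  qed
  have dec: "V n \<subseteq> V m" if "m \<le> n" for m n
    using that dec1 by (rule lift_Suc_antimono_le[rotated])
  have SV: "S f \<in> V (Suc n)" if "f \<in> V n" for f n
    unfolding VSuc using that clS[OF VL[OF that]] by (auto simp: image_L2_def)
  have SnV: "(S ^^ n) h \<in> V n" for n
    by (induction n) (use h SV in \<open>auto simp: V0\<close>)
  \<comment> \<open>The orbit of the missed \<open>h\<close> witnesses that every inclusion is
    strict: injectivity cancels one \<open>S\<close> at a time, down to \<open>h\<close> not being
    in the range.\<close>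
  have nSnV: "(S ^^ n) h \<notin> V (Suc n)" for n
  proof (induction n)
    case 0 show ?case using neg by (auto simp: VSuc V0 image_L2_def S_def)
  next
    case (Suc n)
    show ?case
    proof
      assume "(S ^^ Suc n) h \<in> V (Suc (Suc n))"
      then obtain f where f: "f \<in> V (Suc n)" "AE x in M. S f x = S ((S ^^ n) h) x"
        by (auto simp: VSuc[of "Suc n"] image_L2_def)
      note fL = VL[OF f(1)] and gL = VL[OF SnV[of n]]
      have "AE x in M. S (\<lambda>y. f y - (S ^^ n) h y) x = 0"
        using linear_L2_diff[OF lS fL gL] f(2) by eventually_elim simp
      then have "AE x in M. A (\<lambda>y. f y - (S ^^ n) h y) x = z * (f x - (S ^^ n) h x)"
        by (auto simp: S_def)
      then have "AE x in M. f x - (S ^^ n) h x = 0"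
        using inj[OF L2_diff[OF fL gL]] by simp
      then have "(S ^^ n) h \<in> V (Suc n)"
        using closed_subspace_L2_cong_AE[OF V f(1) gL] by simp
      with Suc show False ..
    qed
  qed
  have "\<exists>y\<in>V n. norm_L2 M y = 1 \<and> (\<forall>u\<in>V (Suc n). 1 / 2 \<le> norm_L2 M (\<lambda>x. y x - u x))" for n
  proof -
    obtain v c where v: "v \<in> V (Suc n)" "norm_L2 M (\<lambda>x. c * ((S ^^ n) h x - v x)) = 1"
      "\<And>u. u \<in> V (Suc n) \<Longrightarrow> 1 / 2 \<le> norm_L2 M (\<lambda>x. c * ((S ^^ n) h x - v x) - u x)"
      using Riesz_lemma_L2[OF V VL[OF SnV] nSnV] by blast
    have "(\<lambda>x. c * ((S ^^ n) h x - v x)) \<in> V n"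
      using v(1) dec1 SnV by (intro closed_subspace_L2D(4)[OF V] closed_subspace_L2_diff[OF V]) auto
    with v show ?thesis by (intro bexI[of _ "\<lambda>x. c * ((S ^^ n) h x - v x)"]) auto
  qed
  then obtain y where y: "\<And>n. y n \<in> V n" "\<And>n. norm_L2 M (y n) = 1"
    "\<And>n u. u \<in> V (Suc n) \<Longrightarrow> 1 / 2 \<le> norm_L2 M (\<lambda>x. y n x - u x)"
    by metis
  note yL = VL[OF y(1)] and AyL = bounded_L2_closed[OF bA VL[OF y(1)]]
  have apart: "cmod z / 2 \<le> norm_L2 M (\<lambda>x. A (y n) x - A (y m) x)" if "n < m" for n m
  proof -
    have inV: "S (y n) \<in> V (Suc n)" "y m \<in> V (Suc n)" "S (y m) \<in> V (Suc n)"
      using SV[OF y(1)] y(1)[of m] SV[OF y(1), of m] dec[of "Suc n" m] dec[of "Suc n" "Suc m"] that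
      by auto
    \<comment> \<open>Since \<open>A = S + z\<close>, the difference
      \<open>A (y n) - A (y m)\<close> equals \<open>z (y n - u)\<close> for this \<open>u\<close>.
      All terms of \<open>u\<close> lie in \<open>V (Suc n)\<close> because \<open>m > n\<close>, so
      \<open>y n\<close> has distance at least 1/2 from it.\<close>
    define u where "u = (\<lambda>x. (1/z) * ((S (y m) x + z * y m x) - S (y n) x))"
    have u: "u \<in> V (Suc n)"
      unfolding u_def
      by (intro closed_subspace_L2D(3,4)[OF V] closed_subspace_L2_diff[OF V] inV)
    have "cmod z / 2 \<le> cmod z * norm_L2 M (\<lambda>x. y n x - u x)"
      using mult_left_mono[OF y(3)[OF u], of "cmod z"] by simp
    also have "\<dots> = norm_L2 M (\<lambda>x. z * (y n x - u x))" by (simp add: norm_L2_mult_left)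
    also have "(\<lambda>x. z * (y n x - u x)) = (\<lambda>x. A (y n) x - A (y m) x)"
      using z by (auto simp: u_def S_def field_simps)
    finally show ?thesis .
  qed
  obtain g s where g: "g \<in> L2 M" and s: "strict_mono (s :: nat \<Rightarrow> nat)"
    and lim: "(\<lambda>n. norm_L2 M (\<lambda>x. A (y (s n)) x - g x)) \<longlonglongrightarrow> 0"
    using compact_L2_subseq[of M A y 1, OF A yL eq_refl[OF y(2)]] .
  have "\<forall>\<^sub>F n in sequentially. norm_L2 M (\<lambda>x. A (y (s n)) x - g x) < cmod z / 4"
    using order_tendstoD(2)[OF lim, of "cmod z / 4"] z by simp
  then obtain N where N: "\<And>n. n \<ge> N \<Longrightarrow> norm_L2 M (\<lambda>x. A (y (s n)) x - g x) < cmod z / 4"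
    by (auto simp: eventually_sequentially)
  have "norm_L2 M (\<lambda>x. A (y (s N)) x - A (y (s (Suc N))) x)
      \<le> norm_L2 M (\<lambda>x. A (y (s N)) x - g x) + norm_L2 M (\<lambda>x. g x - A (y (s (Suc N))) x)"
    by (rule norm_L2_diff_triangle[OF AyL g AyL])
  also have "\<dots> < cmod z / 2"
    using N[of N] N[of "Suc N"] norm_L2_minus_commute[of M g "A (y (s (Suc N)))"] by simp
  finally show False
    using apart[of "s N" "s (Suc N)"] s by (simp add: strict_mono_def)
qed

text \<open>Without an eigenfunction \<open>A - z\<close> is injective, hence bounded below and
  surjective. The inverse is then bounded by \<open>1 / c\<close>, so \<open>z\<close> would be a
  regular value.\<close>

theorem Fredholm_alternative_L2:
  assumes A: "compact_L2 M A" and z: "z \<noteq> 0" and spec: "z \<in> spectrum_L2 M A"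
  shows "\<exists>f. eigenfunction_L2 M A z f"
proof (rule ccontr)
  assume "\<not> ?thesis"
  then have inj: "f \<in> L2 M \<Longrightarrow> AE x in M. A f x = z * f x \<Longrightarrow> AE x in M. f x = 0" for f
    unfolding eigenfunction_L2_def by blast
  obtain c where c: "c > 0" "\<And>f. f \<in> L2 M \<Longrightarrow> c * norm_L2 M f \<le> norm_L2 M (\<lambda>x. A f x - z * f x)"
    by (rule compact_L2_minus_scalar_bounded_below[OF A z]) (use inj in auto)
  define S where "S = (\<lambda>f x. A f x - z * f x)"
  have S: "bounded_L2 M S"
    unfolding S_def by (rule bounded_L2_minus_scalar[OF compact_imp_bounded_L2[OF A]])
  note lS = bounded_L2_linear[OF S] and clS = bounded_L2_closed[OF S]
  have injS: "AE x in M. f x = g x" if f: "f \<in> L2 M" and g: "g \<in> L2 M" and eq: "AE x in M. S f x = S g x" for f g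
  proof -
    have "AE x in M. S (\<lambda>y. f y - g y) x = 0"
      using linear_L2_diff[OF lS f g] eq by eventually_elim simp
    then have "AE x in M. f x - g x = 0"
      by (intro inj L2_diff f g) (simp add: S_def)
    then show ?thesis by simp
  qed
  have "\<forall>h\<in>L2 M. \<exists>f\<in>L2 M. AE x in M. S f x = h x"
    using compact_L2_minus_scalar_surj[OF A z inj] by (simp add: S_def)
  \<comment> \<open>\<open>G\<close> chooses a preimage for each representative separately, with no
    coherence between choices; injectivity of \<open>S\<close> afterwards forces linearity almost
    everywhere.\<close>
  then obtain G where G: "\<And>h. h \<in> L2 M \<Longrightarrow> G h \<in> L2 M" "\<And>h. h \<in> L2 M \<Longrightarrow> AE x in M. S (G h) x = h x"
    by metis
  have add: "AE x in M. G (\<lambda>y. f y + g y) x = G f x + G g x" if f: "f \<in> L2 M" and g: "g \<in> L2 M" for f g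
  proof (rule injS)
    show "AE x in M. S (G (\<lambda>y. f y + g y)) x = S (\<lambda>x. G f x + G g x) x"
      using G(2)[OF L2_add[OF f g]] linear_L2_add[OF lS G(1)[OF f] G(1)[OF g]] G(2)[OF f] G(2)[OF g]
      by eventually_elim simp
  qed (rule G(1) L2_add f g)+
  have mult: "AE x in M. G (\<lambda>y. a * f y) x = a * G f x" if f: "f \<in> L2 M" for a f
  proof (rule injS)
    show "AE x in M. S (G (\<lambda>y. a * f y)) x = S (\<lambda>x. a * G f x) x"
      using G(2)[OF L2_mult_left[OF f, of a]] linear_L2_mult[OF lS G(1)[OF f], of a] G(2)[OF f]
      by eventually_elim simp
  qed (rule G(1) L2_mult_left f)+
  have bd: "norm_L2 M (G h) \<le> (1 / c) * norm_L2 M h" if h: "h \<in> L2 M" for h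
    using c(2)[OF G(1)[OF h]] norm_L2_cong_AE[OF clS[OF G(1)[OF h]] h G(2)[OF h]] c(1)
    by (simp add: S_def field_simps)
  have "bounded_L2 M G"
    unfolding bounded_L2_def linear_L2_def
    by (intro conjI ballI allI exI[of _ "1 / c"] G(1) add mult bd)
  moreover have "AE x in M. G (\<lambda>y. A f y - z * f y) x = f x" if f: "f \<in> L2 M" for f
    using injS[OF G(1)[OF clS[OF f]] f G(2)[OF clS[OF f]]] by (simp add: S_def)
  moreover have "AE x in M. A (G f) x - z * G f x = f x" if f: "f \<in> L2 M" for f
    using G(2)[OF f] by (simp add: S_def)
  ultimately have "z \<notin> spectrum_L2 M A"
    by (auto simp: spectrum_L2_def)
  with spec show False by contradiction
qed

section \<open>Gelfand's bound for the powers of an operator\<close>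

text \<open>For \<open>u\<close> nonzero, \<open>1 - u A = (- u) (A - 1 / u)\<close>, so the inverse
  is \<open>- 1 / u\<close> times that of \<open>A - 1 / u\<close>. For \<open>u = 0\<close> it is
  the identity.\<close>

lemma ex_resolvent_L2:
  assumes A: "bounded_L2 M A" and u: "u = 0 \<or> 1 / u \<notin> spectrum_L2 M A"
  shows "\<exists>S. bounded_L2 M S \<and> (\<forall>f\<in>L2 M. (AE x in M. S (\<lambda>y. f y - u * A f y) x = f x) \<and>
     (AE x in M. S f x - u * A (S f) x = f x))"
proof (cases "u = 0")
  case True
  then show ?thesis by (intro exI[of _ id]) (simp add: bounded_L2_id)
next
  case False
  note lA = bounded_L2_linear[OF A] and clA = bounded_L2_closed[OF A]
  obtain S where S: "bounded_L2 M S"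
    and left: "\<And>f. f \<in> L2 M \<Longrightarrow> AE x in M. S (\<lambda>y. A f y - (1 / u) * f y) x = f x"
    and right: "\<And>f. f \<in> L2 M \<Longrightarrow> AE x in M. A (S f) x - (1 / u) * S f x = f x"
    using u False unfolding spectrum_L2_def by blast
  define S' where "S' = (\<lambda>f x. (- 1 / u) * S f x)"
  have "bounded_L2 M S'"
    using bounded_L2_shift[OF S, of "- 1 / u" 0] by (simp add: S'_def)
  moreover have "AE x in M. S' (\<lambda>y. f y - u * A f y) x = f x" if f: "f \<in> L2 M" for f
  proof -
    have "(\<lambda>y. f y - u * A f y) = (\<lambda>y. (- u) * (A f y - (1 / u) * f y))"
      using False by (auto simp: field_simps)
    moreover have "AE x in M. S (\<lambda>y. (- u) * (A f y - (1 / u) * f y)) x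
        = (- u) * S (\<lambda>y. A f y - (1 / u) * f y) x"
      by (rule linear_L2_mult[OF bounded_L2_linear[OF S] L2_diff[OF clA[OF f] L2_mult_left[OF f]]])
    ultimately have "AE x in M. S (\<lambda>y. f y - u * A f y) x
        = (- u) * S (\<lambda>y. A f y - (1 / u) * f y) x" by simp
    with left[OF f] show ?thesis
      unfolding S'_def by eventually_elim (use False in simp)
  qed
  moreover have "AE x in M. S' f x - u * A (S' f) x = f x" if f: "f \<in> L2 M" for f
  proof -
    have "AE x in M. A (S' f) x = (- 1 / u) * A (S f) x"
      unfolding S'_def by (rule linear_L2_mult[OF lA bounded_L2_closed[OF S f]])
    with right[OF f] show ?thesis
      unfolding S'_def by eventually_elim (use False in \<open>simp add: field_simps\<close>)
  qed
  ultimately show ?thesis by (intro exI[of _ S'] conjI ballI)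
qed

text \<open>\<open>R u\<close> is an inverse of \<open>1 - u A\<close>, chosen for each
  \<open>u\<close> independently; its regularity in \<open>u\<close> is not assumed but follows from
  the resolvent identity.\<close>

locale resolvent_family_L2 =
  fixes M :: "'a measure" and A :: "('a \<Rightarrow> complex) \<Rightarrow> ('a \<Rightarrow> complex)"
    and D :: "complex set" and R :: "complex \<Rightarrow> ('a \<Rightarrow> complex) \<Rightarrow> ('a \<Rightarrow> complex)"
  assumes A: "bounded_L2 M A" and D: "open D" "0 \<in> D"
    and R: "\<And>u. u \<in> D \<Longrightarrow> bounded_L2 M (R u)"
    and left: "\<And>u f. u \<in> D \<Longrightarrow> f \<in> L2 M \<Longrightarrow> AE x in M. R u (\<lambda>y. f y - u * A f y) x = f x"
    and right: "\<And>u f. u \<in> D \<Longrightarrow> f \<in> L2 M \<Longrightarrow> AE x in M. R u f x - u * A (R u f) x = f x"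
begin

lemma R_L2: "u \<in> D \<Longrightarrow> f \<in> L2 M \<Longrightarrow> R u f \<in> L2 M"
  using bounded_L2_closed[OF R] .

lemma A_L2: "f \<in> L2 M \<Longrightarrow> A f \<in> L2 M"
  using bounded_L2_closed[OF A] .

text \<open>With \<open>g = R u f\<close>, the relation \<open>(1 - u A) g = f\<close> reads
  \<open>(1 - t A) g = f + (u - t) A g\<close>; applying \<open>R t\<close> gives the claim.\<close>

lemma resolvent_identity:
  assumes u: "u \<in> D" and t: "t \<in> D" and f: "f \<in> L2 M"
  shows "AE x in M. R u f x = R t f x + (u - t) * R t (A (R u f)) x"
proof -
  let ?g = "R u f"
  have g: "?g \<in> L2 M" and Ag: "A ?g \<in> L2 M" using R_L2[OF u f] A_L2 by auto
  have "AE x in M. ?g x - t * A ?g x = f x + (u - t) * A ?g x"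
    using right[OF u f] by eventually_elim (simp add: algebra_simps)
  then have "AE x in M. R t (\<lambda>x. ?g x - t * A ?g x) x = R t (\<lambda>x. f x + (u - t) * A ?g x) x"
    by (rule bounded_L2_cong_AE[OF R[OF t] L2_diff[OF g L2_mult_left[OF Ag]]
          L2_add[OF f L2_mult_left[OF Ag]]])
  with left[OF t g] linear_L2_add[OF bounded_L2_linear[OF R[OF t]] f L2_mult_left[OF Ag, of "u - t"]]
    linear_L2_mult[OF bounded_L2_linear[OF R[OF t]] Ag, of "u - t"]
  show ?thesis by eventually_elim simp
qed

text \<open>One step of the Neumann expansion, taken from the left inverse property; iterating it
  produces the Taylor coefficients at 0.\<close>

lemma resolvent_expand:
  assumes u: "u \<in> D" and f: "f \<in> L2 M"
  shows "AE x in M. R u f x = f x + u * R u (A f) x"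
  using left[OF u f] linear_L2_diff[OF bounded_L2_linear[OF R[OF u]] f L2_mult_left[OF A_L2[OF f], of u]]
    linear_L2_mult[OF bounded_L2_linear[OF R[OF u]] A_L2[OF f], of u]
  by eventually_elim (simp add: algebra_simps)

text \<open>The resolvent identity bounds the difference by \<open>|u - t| b a\<close> times the
  norm of \<open>R u f\<close> itself. The radius \<open>1 / (2 b a)\<close> makes this at most half
  that norm, which is absorbed on the left and leaves \<open>2 b\<close>.\<close>

lemma resolvent_Lipschitz:
  assumes t: "t \<in> D"
  obtains \<delta> K L where "\<delta> > 0" and "K > 0"
    and "\<And>u f. u \<in> D \<Longrightarrow> cmod (u - t) < \<delta> \<Longrightarrow> f \<in> L2 M \<Longrightarrow> norm_L2 M (R u f) \<le> K * norm_L2 M f"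
    and "\<And>u f. u \<in> D \<Longrightarrow> cmod (u - t) < \<delta> \<Longrightarrow> f \<in> L2 M \<Longrightarrow>
      norm_L2 M (\<lambda>x. R u f x - R t f x) \<le> L * cmod (u - t) * norm_L2 M f"
proof -
  obtain a where a: "a > 0" "\<And>f. f \<in> L2 M \<Longrightarrow> norm_L2 M (A f) \<le> a * norm_L2 M f"
    using bounded_L2_bound[OF A] by metis
  obtain b where b: "b > 0" "\<And>f. f \<in> L2 M \<Longrightarrow> norm_L2 M (R t f) \<le> b * norm_L2 M f"
    using bounded_L2_bound[OF R[OF t]] by metis
  have diff: "norm_L2 M (\<lambda>x. R u f x - R t f x) \<le> cmod (u - t) * (b * a) * norm_L2 M (R u f)"
    if u: "u \<in> D" and f: "f \<in> L2 M" for u f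
  proof -
    note Rf = R_L2[OF u f]
    have "norm_L2 M (\<lambda>x. R u f x - R t f x) = norm_L2 M (\<lambda>x. (u - t) * R t (A (R u f)) x)"
      using resolvent_identity[OF u t f]
      by (intro norm_L2_cong_AE L2_diff L2_mult_left R_L2 A_L2 u t f) auto
    also have "\<dots> \<le> cmod (u - t) * (b * (a * norm_L2 M (R u f)))"
      unfolding norm_L2_mult_left
      using order_trans[OF b(2)[OF A_L2[OF Rf]] mult_left_mono[OF a(2)[OF Rf]]] b(1)
      by (intro mult_left_mono) auto
    finally show ?thesis by (simp add: mult.assoc)
  qed
  have bd: "norm_L2 M (R u f) \<le> 2 * b * norm_L2 M f"
    if u: "u \<in> D" and ut: "cmod (u - t) < 1 / (2 * (b * a))" and f: "f \<in> L2 M" for u f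
  proof -
    have "cmod (u - t) * (b * a) \<le> 1 / 2"
      using ut a(1) b(1) by (simp add: field_simps)
    then have "cmod (u - t) * (b * a) * norm_L2 M (R u f) \<le> 1 / 2 * norm_L2 M (R u f)"
      by (rule mult_right_mono) simp
    then show ?thesis
      using diff[OF u f] norm_L2_diff_le[OF R_L2[OF u f] R_L2[OF t f]] b(2)[OF f] by linarith
  qed
  show thesis
  proof (rule that[of "1 / (2 * (b * a))" "2 * b" "b * a * (2 * b)"])
    fix u f assume u: "u \<in> D" and ut: "cmod (u - t) < 1 / (2 * (b * a))" and f: "f \<in> L2 M"
    show "norm_L2 M (R u f) \<le> 2 * b * norm_L2 M f" by (rule bd[OF u ut f])
    have "cmod (u - t) * (b * a) * norm_L2 M (R u f)
        \<le> cmod (u - t) * (b * a) * (2 * b * norm_L2 M f)"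
      using a(1) b(1) by (intro mult_left_mono bd[OF u ut f]) auto
    with diff[OF u f]
    show "norm_L2 M (\<lambda>x. R u f x - R t f x) \<le> b * a * (2 * b) * cmod (u - t) * norm_L2 M f"
      by (simp add: mult.commute mult.left_commute)
  qed (use a(1) b(1) in auto)
qed

text \<open>The local bounds are combined over a finite subcover; their sum serves in place of their
  maximum.\<close>

lemma resolvent_uniform_bound:
  assumes C: "compact C" "C \<subseteq> D"
  obtains K where "K \<ge> 0" and "\<And>u f. u \<in> C \<Longrightarrow> f \<in> L2 M \<Longrightarrow> norm_L2 M (R u f) \<le> K * norm_L2 M f"
proof -
  have "\<exists>\<delta> K. \<delta> > 0 \<and> K > 0 \<and> (\<forall>u\<in>D. cmod (u - t) < \<delta> \<longrightarrow>
      (\<forall>f\<in>L2 M. norm_L2 M (R u f) \<le> K * norm_L2 M f))" if t: "t \<in> D" for t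
    by (rule resolvent_Lipschitz[OF t]) blast
  then obtain \<delta> K where \<delta>K: "\<And>t. t \<in> D \<Longrightarrow> \<delta> t > 0" "\<And>t. t \<in> D \<Longrightarrow> K t > (0::real)"
    "\<And>t u f. t \<in> D \<Longrightarrow> u \<in> D \<Longrightarrow> cmod (u - t) < \<delta> t \<Longrightarrow> f \<in> L2 M \<Longrightarrow>
      norm_L2 M (R u f) \<le> K t * norm_L2 M f"
    by metis
  obtain C' where C': "C' \<subseteq> C" "finite C'" "C \<subseteq> (\<Union>t\<in>C'. ball t (\<delta> t))"
  proof (rule compactE_image[OF C(1), of C "\<lambda>t. ball t (\<delta> t)"])
    show "C \<subseteq> (\<Union>t\<in>C. ball t (\<delta> t))"
    proof
      fix u assume "u \<in> C"
      then show "u \<in> (\<Union>t\<in>C. ball t (\<delta> t))" using \<delta>K(1)[of u] C(2) by (intro UN_I[of u]) auto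
    qed
  qed auto
  show thesis
  proof (rule that[of "\<Sum>t\<in>C'. K t"])
    show "0 \<le> (\<Sum>t\<in>C'. K t)"
      using C'(1) C(2) \<delta>K(2) by (intro sum_nonneg) (meson less_imp_le subsetD)
  next
    fix u f assume u: "u \<in> C" and f: "f \<in> L2 M"
    obtain t where t: "t \<in> C'" "u \<in> ball t (\<delta> t)" using C'(3) u by blast
    then have "norm_L2 M (R u f) \<le> K t * norm_L2 M f"
      using C'(1) C(2) u f by (intro \<delta>K(3)) (auto simp: dist_norm norm_minus_commute)
    also have "K t \<le> (\<Sum>t\<in>C'. K t)"
      using t(1) C' C(2) by (intro member_le_sum less_imp_le[OF \<delta>K(2)]) auto
    finally show "norm_L2 M (R u f) \<le> (\<Sum>t\<in>C'. K t) * norm_L2 M f"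
      by (simp add: mult_right_mono)
  qed
qed

text \<open>By the resolvent identity the difference quotient is exactly the pairing of
  \<open>R t (A (R u f))\<close> with \<open>g\<close>, and \<open>R u f\<close> tends to
  \<open>R t f\<close> by the Lipschitz estimate.\<close>

lemma resolvent_field_derivative:
  assumes t: "t \<in> D" and f: "f \<in> L2 M" and g: "g \<in> L2 M"
  shows "((\<lambda>u. inner_L2 M (R u f) g) has_field_derivative inner_L2 M (R t (A (R t f))) g) (at t)"
proof -
  obtain \<delta> K L where \<delta>: "\<delta> > 0"
    and L: "\<And>u f. u \<in> D \<Longrightarrow> cmod (u - t) < \<delta> \<Longrightarrow> f \<in> L2 M \<Longrightarrow>
      norm_L2 M (\<lambda>x. R u f x - R t f x) \<le> L * cmod (u - t) * norm_L2 M f"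
    by (rule resolvent_Lipschitz[OF t]) blast
  have RA: "bounded_L2 M (R t \<circ> A)" by (rule bounded_L2_comp[OF R[OF t] A])
  obtain c where c: "c > 0" "\<And>f. f \<in> L2 M \<Longrightarrow> norm_L2 M ((R t \<circ> A) f) \<le> c * norm_L2 M f"
    using bounded_L2_bound[OF RA] by metis
  let ?\<phi> = "\<lambda>u. inner_L2 M (R u f) g"
  let ?d = "inner_L2 M (R t (A (R t f))) g"
  let ?b = "\<lambda>u. c * L * norm_L2 M f * norm_L2 M g * cmod (u - t)"
  have le: "norm ((?\<phi> u - ?\<phi> t) / (u - t) - ?d) \<le> ?b u"
    if u: "u \<in> D" "cmod (u - t) < \<delta>" "u \<noteq> t" for u
  proof -
    note mem = R_L2[OF u(1) f] R_L2[OF t f] R_L2[OF t A_L2[OF R_L2[OF u(1) f]]]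
      R_L2[OF t A_L2[OF R_L2[OF t f]]]
    have "?\<phi> u = inner_L2 M (\<lambda>x. R t f x + (u - t) * R t (A (R u f)) x) g"
      by (rule inner_L2_cong_AE[OF mem(1) L2_add[OF mem(2) L2_mult_left[OF mem(3)]] g
            resolvent_identity[OF u(1) t f]])
    also have "\<dots> = ?\<phi> t + (u - t) * inner_L2 M (R t (A (R u f))) g"
      using inner_L2_add_left[OF mem(2) L2_mult_left[OF mem(3)] g] by (simp add: inner_L2_mult_left)
    finally have "(?\<phi> u - ?\<phi> t) / (u - t) - ?d = inner_L2 M (R t (A (R u f))) g - ?d"
      using u(3) by simp
    also have "\<dots> = inner_L2 M (\<lambda>x. R t (A (R u f)) x - R t (A (R t f)) x) g"
      using inner_L2_diff_left[OF mem(3,4) g] by simp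
    also have "norm \<dots> \<le> norm_L2 M (\<lambda>x. R t (A (R u f)) x - R t (A (R t f)) x) * norm_L2 M g"
      by (rule inner_L2_Cauchy_Schwarz[OF L2_diff[OF mem(3,4)] g])
    also have "\<dots> \<le> (c * (L * cmod (u - t) * norm_L2 M f)) * norm_L2 M g"
      using order_trans[OF bounded_L2_norm_diff[OF RA c(2) mem(1,2)]
          mult_left_mono[OF L[OF u(1,2) f]]] c(1)
      by (intro mult_right_mono) auto
    finally show ?thesis by (simp add: mult_ac)
  qed
  have ev: "\<forall>\<^sub>F u in at t. u \<in> D \<and> cmod (u - t) < \<delta> \<and> u \<noteq> t"
  proof (intro eventually_conj)
    show "\<forall>\<^sub>F u in at t. u \<in> D" using eventually_at_in_open'[OF D(1) t] .
    show "\<forall>\<^sub>F u in at t. cmod (u - t) < \<delta>"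
      using \<delta> by (auto simp: eventually_at dist_norm)
    show "\<forall>\<^sub>F u in at t. u \<noteq> t" by (simp add: eventually_at_filter)
  qed
  have "((\<lambda>u. (?\<phi> u - ?\<phi> t) / (u - t) - ?d) \<longlongrightarrow> 0) (at t)"
  proof (rule Lim_null_comparison)
    show "\<forall>\<^sub>F u in at t. norm ((?\<phi> u - ?\<phi> t) / (u - t) - ?d) \<le> ?b u"
      using ev by eventually_elim (use le in blast)
    show "(?b \<longlongrightarrow> 0) (at t)"
      by (auto intro!: tendsto_eq_intros)
  qed
  then show ?thesis
    unfolding has_field_derivative_iff by (rule LIM_zero_cancel)
qed

lemma resolvent_holomorphic:
  assumes "f \<in> L2 M" "g \<in> L2 M"
  shows "(\<lambda>u. inner_L2 M (R u f) g) holomorphic_on D"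
  unfolding holomorphic_on_def field_differentiable_def
  using has_field_derivative_at_within[OF resolvent_field_derivative[OF _ assms]] by blast

text \<open>Write \<phi> for the pairing of \<open>R u f\<close> and \<psi> for that of
  \<open>R u (A f)\<close>. The expansion gives \<phi> as a constant plus \<open>u\<close> times
  \<psi>, so passing from \<open>f\<close> to \<open>A f\<close> shifts the coefficients by
  one.\<close>

lemma resolvent_Taylor_coeff:
  assumes "f \<in> L2 M" and g: "g \<in> L2 M"
  shows "(deriv ^^ n) (\<lambda>u. inner_L2 M (R u f) g) 0 = fact n * inner_L2 M ((A ^^ n) f) g"
  using assms(1)
proof (induction n arbitrary: f)
  case (0 f)
  then show ?case
    using inner_L2_cong_AE[OF R_L2[OF D(2) 0] 0 g] right[OF D(2) 0] by simp
next
  case (Suc n f)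
  let ?\<phi> = "\<lambda>u. inner_L2 M (R u f) g"
  let ?\<psi> = "\<lambda>u. inner_L2 M (R u (A f)) g"
  note Af = A_L2[OF Suc.prems]
  have hol: "?\<psi> holomorphic_on D" by (rule resolvent_holomorphic[OF Af g])
  have eq: "?\<phi> u = inner_L2 M f g + u * ?\<psi> u" if u: "u \<in> D" for u
  proof -
    have "?\<phi> u = inner_L2 M (\<lambda>x. f x + u * R u (A f) x) g"
      by (rule inner_L2_cong_AE[OF R_L2[OF u Suc.prems]
          L2_add[OF Suc.prems L2_mult_left[OF R_L2[OF u Af]]] g resolvent_expand[OF u Suc.prems]])
    then show ?thesis
      using inner_L2_add_left[OF Suc.prems L2_mult_left[OF R_L2[OF u Af]] g]
      by (simp add: inner_L2_mult_left)
  qed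
  have "(deriv ^^ Suc n) ?\<phi> 0 = (deriv ^^ Suc n) (\<lambda>u. inner_L2 M f g + u * ?\<psi> u) 0"
    using eq by (intro higher_deriv_transform_within_open[OF _ _ D(1,2)] holomorphic_intros
        resolvent_holomorphic Suc.prems Af g) auto
  also have "\<dots> = (deriv ^^ Suc n) (\<lambda>u. inner_L2 M f g) 0 + (deriv ^^ Suc n) (\<lambda>u. u * ?\<psi> u) 0"
    by (intro higher_deriv_add[OF _ _ D] holomorphic_intros hol)
  also have "(deriv ^^ Suc n) (\<lambda>u. inner_L2 M f g) 0 = 0"
    by (subst higher_deriv_const) simp
  also have "(deriv ^^ Suc n) (\<lambda>u. u * ?\<psi> u) 0
      = (\<Sum>i = 0..Suc n. of_nat (Suc n choose i) * (deriv ^^ i) (\<lambda>u. u) 0 * (deriv ^^ (Suc n - i)) ?\<psi> 0)"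
    by (intro higher_deriv_mult[OF _ _ D] holomorphic_intros hol)
  \<comment> \<open>In Leibniz' rule at 0 only \<open>i = 1\<close> survives: \<open>u\<close>
    itself vanishes there, and so do its derivatives of order at least 2.\<close>
  also have "\<dots> = (\<Sum>i\<in>{1}. of_nat (Suc n choose i) * (deriv ^^ i) (\<lambda>u. u) 0 * (deriv ^^ (Suc n - i)) ?\<psi> 0)"
    by (intro sum.mono_neutral_right) (auto simp: higher_deriv_ident)
  also have "\<dots> = of_nat (Suc n) * (deriv ^^ n) ?\<psi> 0"
    by (simp add: higher_deriv_ident)
  also have "\<dots> = fact (Suc n) * inner_L2 M ((A ^^ n) (A f)) g"
    using Suc.IH[OF Af] by simp
  finally show ?case by (simp add: funpow_swap1)
qed

lemma power_bound:
  assumes \<tau>: "\<tau> > 0" "cball 0 \<tau> \<subseteq> D"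
  obtains K where "K > 0"
    and "\<And>k f. f \<in> L2 M \<Longrightarrow> norm_L2 M ((A ^^ k) f) \<le> K * (1 / \<tau>) ^ k * norm_L2 M f"
proof -
  obtain K where K: "K \<ge> 0"
      "\<And>u f. u \<in> cball 0 \<tau> \<Longrightarrow> f \<in> L2 M \<Longrightarrow> norm_L2 M (R u f) \<le> K * norm_L2 M f"
    using resolvent_uniform_bound[OF compact_cball \<tau>(2)] by metis
  have bd: "norm_L2 M ((A ^^ k) f) \<le> K * (1 / \<tau>) ^ k * norm_L2 M f" if f: "f \<in> L2 M" for k f
  proof -
    \<comment> \<open>With this \<open>g\<close> the \<open>k\<close>-th coefficient is the squared
      norm of \<open>g\<close>, while the bound on the circle is linear in that norm; one factor
      cancels.\<close>
    define g where "g = (A ^^ k) f"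
    have g: "g \<in> L2 M" unfolding g_def by (rule bounded_L2_closed[OF bounded_L2_funpow[OF A] f])
    have hol: "(\<lambda>u. inner_L2 M (R u f) g) holomorphic_on D" by (rule resolvent_holomorphic[OF f g])
    have "norm ((deriv ^^ k) (\<lambda>u. inner_L2 M (R u f) g) 0)
        \<le> fact k * (K * norm_L2 M f * norm_L2 M g) / \<tau> ^ k"
    proof (rule Cauchy_inequality)
      show "(\<lambda>u. inner_L2 M (R u f) g) holomorphic_on ball 0 \<tau>"
        by (rule holomorphic_on_subset[OF hol order_trans[OF ball_subset_cball \<tau>(2)]])
      show "continuous_on (cball 0 \<tau>) (\<lambda>u. inner_L2 M (R u f) g)"
        using holomorphic_on_imp_continuous_on[OF hol] \<tau>(2) by (rule continuous_on_subset)
      fix u :: complex assume "cmod (0 - u) = \<tau>"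
      then have u: "u \<in> cball 0 \<tau>" by simp
      then have "u \<in> D" using \<tau>(2) by blast
      show "cmod (inner_L2 M (R u f) g) \<le> K * norm_L2 M f * norm_L2 M g"
        using inner_L2_Cauchy_Schwarz[OF R_L2[OF \<open>u \<in> D\<close> f] g]
          mult_right_mono[OF K(2)[OF u f] norm_L2_nonneg[of M g]] by linarith
    qed (rule \<tau>(1))
    then have "fact k * cmod (inner_L2 M g g) \<le> fact k * (K * norm_L2 M f * norm_L2 M g / \<tau> ^ k)"
      unfolding resolvent_Taylor_coeff[OF f g] by (simp add: norm_mult g_def)
    then have le: "(norm_L2 M g)\<^sup>2 \<le> K * norm_L2 M f * norm_L2 M g / \<tau> ^ k"
      by (subst (asm) mult_le_cancel_left_pos) (auto simp: inner_L2_self norm_power)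
    show ?thesis
    proof (cases "norm_L2 M g = 0")
      case True
      then show ?thesis using K(1) \<tau>(1) by (simp add: g_def[symmetric])
    next
      case False
      then have "norm_L2 M g > 0" using norm_L2_nonneg[of M g] by linarith
      moreover have "norm_L2 M g * norm_L2 M g \<le> (K * norm_L2 M f / \<tau> ^ k) * norm_L2 M g"
        using le by (simp add: power2_eq_square mult_ac)
      ultimately have "norm_L2 M g \<le> K * norm_L2 M f / \<tau> ^ k"
        by (simp only: mult_le_cancel_right_pos)
      then show ?thesis by (simp add: g_def power_divide field_simps)
    qed
  qed
  show thesis
  proof (rule that)
    fix k f assume f: "f \<in> L2 M"
    \<comment> \<open>\<open>K\<close> is only known to be nonnegative; \<open>K + 1\<close>
      supplies the required positive constant.\<close>
    have "K * (1 / \<tau>) ^ k * norm_L2 M f \<le> (K + 1) * (1 / \<tau>) ^ k * norm_L2 M f"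
      using \<tau>(1) by (intro mult_right_mono) auto
    with bd[OF f] show "norm_L2 M ((A ^^ k) f) \<le> (K + 1) * (1 / \<tau>) ^ k * norm_L2 M f"
      by (rule order_trans)
  qed (use K(1) in simp)
qed

end

theorem power_bound_of_spectrum_L2:
  assumes A: "bounded_L2 M A" and \<rho>: "0 \<le> \<rho>" "\<And>z. z \<in> spectrum_L2 M A \<Longrightarrow> cmod z \<le> \<rho>"
    and s: "\<rho> < s"
  obtains K where "K > 0"
    and "\<And>k f. f \<in> L2 M \<Longrightarrow> norm_L2 M ((A ^^ k) f) \<le> K * s ^ k * norm_L2 M f"
proof -
  \<comment> \<open>A radius strictly between: the resolvent exists on the open disc of radius
    \<open>1 / t\<close>, which contains the closed disc of radius \<open>1 / s\<close>. The
    midpoint is positive even if \<open>\<rho> = 0\<close>.\<close>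
  define t where "t = (\<rho> + s) / 2"
  have t: "\<rho> < t" "t < s" "0 < t" "0 < s" using \<rho>(1) s by (auto simp: t_def)
  have "u = 0 \<or> 1 / u \<notin> spectrum_L2 M A" if "u \<in> ball 0 (1 / t)" for u
  proof (cases "u = 0")
    case False
    have "\<rho> < cmod (1 / u)"
      using that t(1,3) False order.strict_trans[of "\<rho> * cmod u" "t * cmod u" 1]
      by (simp add: norm_divide field_simps)
    then show ?thesis using \<rho>(2)[of "1 / u"] by auto
  qed simp
  then have "\<forall>u\<in>ball 0 (1 / t). \<exists>S. bounded_L2 M S \<and>
      (\<forall>f\<in>L2 M. (AE x in M. S (\<lambda>y. f y - u * A f y) x = f x) \<and>
         (AE x in M. S f x - u * A (S f) x = f x))"
    using ex_resolvent_L2[OF A] by blast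
  from bchoice[OF this] obtain R where R: "\<forall>u\<in>ball 0 (1 / t). bounded_L2 M (R u) \<and>
      (\<forall>f\<in>L2 M. (AE x in M. R u (\<lambda>y. f y - u * A f y) x = f x) \<and>
         (AE x in M. R u f x - u * A (R u f) x = f x))" ..
  interpret resolvent_family_L2 M A "ball 0 (1 / t)" R
    by unfold_locales (use R t in \<open>simp_all add: A\<close>)
  have "1 / s < 1 / t" using t by (simp add: divide_strict_left_mono)
  then have sub: "cball 0 (1 / s) \<subseteq> ball (0::complex) (1 / t)" by auto
  show thesis
  proof (rule power_bound[OF _ sub])
    show "0 < 1 / s" using t by simp
    fix K assume "K > 0"
      and "\<And>k f. f \<in> L2 M \<Longrightarrow> norm_L2 M ((A ^^ k) f) \<le> K * (1 / (1 / s)) ^ k * norm_L2 M f"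
    then show thesis by (intro that[of K]) simp_all
  qed
qed

section \<open>Operators with a positive kernel\<close>

lemma inner_L2_ae_positive_eq_0:
  assumes f: "f \<in> L2 M" and w: "w \<in> L2 M" "ae_positive M w"
    and nonneg: "AE x in M. Im (f x) = 0 \<and> 0 \<le> Re (f x)" and zero: "inner_L2 M f w = 0"
  shows "AE x in M. f x = 0"
proof -
  note int = integrable_mult_L2[OF f w(1)]
  have "(LINT x|M. Re (f x * cnj (w x))) = 0"
    using integral_Re[OF int] zero by (simp add: inner_L2_def)
  moreover have "AE x in M. 0 \<le> Re (f x * cnj (w x))"
    using nonneg w(2) unfolding ae_positive_def by eventually_elim simp
  ultimately have "AE x in M. Re (f x * cnj (w x)) = 0"
    using integral_nonneg_eq_0_iff_AE[OF integrable_Re[OF int]] by blast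
  with nonneg w(2) show ?thesis
    unfolding ae_positive_def by eventually_elim (simp add: complex_eq_iff)
qed

lemma cmod_eq_Re_imp_of_real: "cmod z = Re z \<Longrightarrow> z = complex_of_real (cmod z)"
  using cmod_power2[of z] by (simp add: complex_eq_iff)

locale positive_kernel_L2 = sigma_finite_measure M
  for M :: "'a measure" +
  fixes R :: "'a \<Rightarrow> 'a \<Rightarrow> real" and r :: real and v w :: "'a \<Rightarrow> complex"
  assumes meas: "(\<lambda>(x, y). R x y) \<in> borel_measurable (M \<Otimes>\<^sub>M M)"
    and pos: "\<And>x y. x \<in> space M \<Longrightarrow> y \<in> space M \<Longrightarrow> 0 < R x y"
    and kernel: "L2_kernel M R"
    and closed: "\<And>f. f \<in> L2 M \<Longrightarrow> integral_op M R f \<in> L2 M"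
    and v: "eigenfunction_L2 M (integral_op M R) (of_real r) v" "ae_positive M v"
    and w: "eigenfunction_L2 M (adjoint_integral_op M R) (of_real r) w" "ae_positive M w"
begin

lemma v_L2: "v \<in> L2 M" and w_L2: "w \<in> L2 M"
  using v(1) w(1) by (auto simp: eigenfunction_L2_def)

text \<open>The eigenfunction \<open>v\<close> is not null, so the whole space is not a null set.
  Properties holding almost everywhere can thus be evaluated at an actual point.\<close>

lemma AE_imp_ex:
  assumes "AE x in M. P x"
  shows "\<exists>x\<in>space M. P x"
proof (rule ccontr)
  assume no: "\<not> ?thesis"
  have "AE x in M. v x = 0"
    using assms AE_space by eventually_elim (use no in blast)
  then show False using v(1) by (simp add: eigenfunction_L2_def)
qed

lemma kernel_measurable: "x \<in> space M \<Longrightarrow> (\<lambda>y. R x y) \<in> borel_measurable M"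
  using measurable_Pair2[OF meas] by simp

text \<open>At one point \<open>y\<close> where the eigenvalue equation holds, \<open>r v y\<close>
  is the integral of the strictly positive function \<open>R x y * v x\<close> over a space that is
  not null.\<close>

lemma r_pos: "r > 0"
proof -
  have "AE y in M. integrable M (\<lambda>x. complex_of_real (R x y) * v x)"
    using kernel v_L2 by (simp add: L2_kernel_def)
  moreover have "AE y in M. integral_op M R v y = of_real r * v y"
    using v(1) by (simp add: eigenfunction_L2_def)
  moreover note v(2)[unfolded ae_positive_def]
  ultimately have "AE y in M. integrable M (\<lambda>x. complex_of_real (R x y) * v x)
      \<and> integral_op M R v y = of_real r * v y \<and> Re (v y) > 0"
    by eventually_elim simp
  then obtain y where y: "y \<in> space M" and int: "integrable M (\<lambda>x. complex_of_real (R x y) * v x)"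
    and eq: "integral_op M R v y = of_real r * v y" and vy: "Re (v y) > 0"
    using AE_imp_ex by blast
  have AEpos: "AE x in M. 0 < Re (complex_of_real (R x y) * v x)"
    using v(2) AE_space unfolding ae_positive_def by eventually_elim (use pos y in simp)
  then have nonneg: "AE x in M. 0 \<le> Re (complex_of_real (R x y) * v x)"
    by eventually_elim simp
  have "(LINT x|M. Re (complex_of_real (R x y) * v x)) = r * Re (v y)"
    using integral_Re[OF int] eq by (simp add: integral_op_def)
  moreover have "(LINT x|M. Re (complex_of_real (R x y) * v x)) \<noteq> 0"
  proof
    assume "(LINT x|M. Re (complex_of_real (R x y) * v x)) = 0"
    then have "AE x in M. Re (complex_of_real (R x y) * v x) = 0"
      using integral_nonneg_eq_0_iff_AE[OF integrable_Re[OF int] nonneg] by simp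
    with AEpos have "AE x in M. 0 < Re (complex_of_real (R x y) * v x)
        \<and> Re (complex_of_real (R x y) * v x) = 0"
      by eventually_elim (rule conjI)
    then show False using AE_imp_ex by fastforce
  qed
  moreover have "(LINT x|M. Re (complex_of_real (R x y) * v x)) \<ge> 0"
    using nonneg by (rule integral_nonneg_AE)
  ultimately have "r * Re (v y) > 0" by linarith
  with vy show ?thesis by (simp add: zero_less_mult_iff)
qed

text \<open>\<open>L2_kernel\<close> concerns integration over the first argument only. For the
  transposed kernel the default value 0 of a nonexistent integral is exploited: here the integral
  equals \<open>r * w x\<close>, which is nonzero.\<close>

lemma adjoint_w_integrable: "AE x in M. integrable M (\<lambda>y. complex_of_real (R x y) * w y)"
proof -
  have "AE x in M. adjoint_integral_op M R w x = of_real r * w x"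
    using w(1) by (simp add: eigenfunction_L2_def)
  with w(2) show ?thesis
    unfolding ae_positive_def
  proof eventually_elim
    case (elim x)
    then have "(LINT y|M. complex_of_real (R x y) * w y) \<noteq> 0"
      using r_pos by (auto simp: adjoint_integral_op_def)
    then show ?case using not_integrable_integral_eq by blast
  qed
qed

text \<open>Adjointness tested against \<open>w\<close> alone. Fubini needs absolute integrability
  of \<open>H\<close>, and positivity of \<open>w\<close> provides it: the eigenvalue equation for
  \<open>w\<close> evaluates the inner integral of the modulus as \<open>r * |f x| * |w x|\<close>,
  a product of square-integrable functions.\<close>

lemma inner_integral_op:
  assumes f: "f \<in> L2 M"
  shows "inner_L2 M (integral_op M R f) w = of_real r * inner_L2 M f w"
proof -
  interpret P: pair_sigma_finite M M ..
  have R [measurable]: "(\<lambda>z. R (fst z) (snd z)) \<in> borel_measurable (M \<Otimes>\<^sub>M M)"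
    using meas by (simp add: case_prod_beta')
  have [measurable]: "f \<in> borel_measurable M" "w \<in> borel_measurable M"
    using f w_L2 by (auto simp: L2_def)
  define H where "H = (\<lambda>x y. complex_of_real (R x y) * f x * cnj (w y))"
  have H: "case_prod H \<in> borel_measurable (M \<Otimes>\<^sub>M M)"
    unfolding H_def case_prod_beta' by measurable
  have adj: "AE x in M. (LINT y|M. complex_of_real (R x y) * w y) = of_real r * w x"
    using w(1) by (simp add: eigenfunction_L2_def adjoint_integral_op_def)
  have abs_w: "AE x in M. complex_of_real (cmod (w x)) = w x"
    using w(2) unfolding ae_positive_def
    by eventually_elim (simp add: complex_eq_iff cmod_def)
  have norm_H: "AE x in M. (LINT y|M. norm (H x y)) = r * norm (f x * cnj (w x))"
    using adj abs_w AE_space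
  proof eventually_elim
    case (elim x)
    note [measurable] = kernel_measurable[OF elim(3)]
    have "complex_of_real (LINT y|M. R x y * cmod (w y)) = (LINT y|M. complex_of_real (R x y * cmod (w y)))"
      by (rule integral_complex_of_real[symmetric])
    also have "\<dots> = (LINT y|M. complex_of_real (R x y) * w y)"
      using abs_w by (intro integral_cong_AE) auto
    also have "\<dots> = of_real (r * cmod (w x))"
      using elim(1,2) by simp
    finally have "(LINT y|M. R x y * cmod (w y)) = r * cmod (w x)"
      by (simp only: of_real_eq_iff)
    moreover have "(LINT y|M. norm (H x y)) = (LINT y|M. cmod (f x) * (R x y * cmod (w y)))"
      using pos[OF elim(3)] by (intro Bochner_Integration.integral_cong) (auto simp: H_def norm_mult abs_of_pos)
    ultimately show ?case by (simp add: norm_mult)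
  qed
  have int_H: "integrable (M \<Otimes>\<^sub>M M) (case_prod H)"
  proof (rule P.Fubini_integrable[OF H])
    have "integrable M (\<lambda>x. r * norm (f x * cnj (w x)))"
      using integrable_norm[OF integrable_mult_L2[OF f w_L2]] by simp
    then show "integrable M (\<lambda>x. LINT y|M. norm (case_prod H (x, y)))"
    proof (rule integrable_cong_AE_imp)
      show "(\<lambda>x. LINT y|M. norm (case_prod H (x, y))) \<in> borel_measurable M"
        using H by measurable
      show "AE x in M. r * norm (f x * cnj (w x)) = (LINT y|M. norm (case_prod H (x, y)))"
        using norm_H by eventually_elim simp
    qed
    show "AE x in M. integrable M (\<lambda>y. case_prod H (x, y))"
      using adjoint_w_integrable
    proof eventually_elim
      case (elim x)
      then have "integrable M (\<lambda>y. f x * cnj (complex_of_real (R x y) * w y))"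
        by (intro integrable_mult_right integrable_cnj)
      then show ?case by (simp add: H_def mult_ac)
    qed
  qed
  have "inner_L2 M (integral_op M R f) w = (LINT y|M. LINT x|M. H x y)"
    by (simp add: inner_L2_def integral_op_def H_def)
  also have "\<dots> = (LINT x|M. LINT y|M. H x y)"
    by (rule P.Fubini_integral[OF int_H])
  also have "\<dots> = (LINT x|M. of_real r * (f x * cnj (w x)))"
  proof (rule integral_cong_AE)
    show "(\<lambda>x. LINT y|M. H x y) \<in> borel_measurable M"
      using H by measurable
    show "AE x in M. (LINT y|M. H x y) = of_real r * (f x * cnj (w x))"
      using adj
    proof eventually_elim
      case (elim x)
      have "(LINT y|M. H x y) = (LINT y|M. f x * cnj (complex_of_real (R x y) * w y))"
        by (simp add: H_def mult_ac)
      also have "\<dots> = f x * cnj (LINT y|M. complex_of_real (R x y) * w y)"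
        by (simp only: integral_mult_right_zero Bochner_Integration.integral_cnj)
      finally show ?case using elim by simp
    qed
  qed measurable
  also have "\<dots> = of_real r * inner_L2 M f w"
    by (simp add: inner_L2_def)
  finally show ?thesis .
qed

text \<open>
  Equality must hold in \<open>r\<bar>f\<bar> = \<bar>T f\<bar> \<le> T\<bar>f\<bar>\<close>, because both ends have the same inner product with
  the positive \<open>w\<close>.  Equality in the triangle inequality at one point forces \<open>f\<close> to have constant
  phase, and then \<open>\<langle>f, w\<rangle> = 0\<close> forces \<open>f = 0\<close>.
\<close>
lemma eigenfunction_orthogonal_eq_0:
  assumes f: "f \<in> L2 M" and eig: "AE x in M. integral_op M R f x = of_real r * f x"
    and orth: "inner_L2 M f w = 0"
  shows "AE x in M. f x = 0"
proof -
  define F where "F = (\<lambda>x. complex_of_real (cmod (f x)))"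
  define p where "p = (\<lambda>y. LINT x|M. R x y * cmod (f x))"
  have F: "F \<in> L2 M" unfolding F_def by (rule L2_norm_fun[OF f])
  have TF: "integral_op M R F = (\<lambda>y. complex_of_real (p y))"
    unfolding integral_op_def F_def p_def by (simp flip: of_real_mult)
  have le: "AE y in M. r * cmod (f y) \<le> p y"
    using eig AE_space
  proof eventually_elim
    case (elim y)
    have "r * cmod (f y) = norm (LINT x|M. complex_of_real (R x y) * f x)"
      using elim(1) r_pos by (simp add: integral_op_def norm_mult)
    also have "\<dots> \<le> (LINT x|M. norm (complex_of_real (R x y) * f x))"
      by (rule integral_norm_bound)
    also have "\<dots> = p y"
      unfolding p_def using pos elim(2)
      by (intro Bochner_Integration.integral_cong) (auto simp: norm_mult abs_of_pos)
    finally show ?case .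
  qed
  have "AE y in M. integral_op M R F y - of_real r * F y = 0"
  proof (rule inner_L2_ae_positive_eq_0[OF _ w_L2 w(2)])
    show "(\<lambda>y. integral_op M R F y - of_real r * F y) \<in> L2 M"
      by (intro L2_diff L2_mult_left closed F)
    show "AE y in M. Im (integral_op M R F y - of_real r * F y) = 0
        \<and> 0 \<le> Re (integral_op M R F y - of_real r * F y)"
      using le unfolding TF by eventually_elim (simp add: F_def)
    show "inner_L2 M (\<lambda>y. integral_op M R F y - of_real r * F y) w = 0"
      using inner_L2_diff_left[OF closed[OF F] L2_mult_left[OF F] w_L2]
      by (simp add: inner_integral_op[OF F] inner_L2_mult_left)
  qed
  moreover have "AE y in M. integrable M (\<lambda>x. complex_of_real (R x y) * f x)"
    using kernel f by (simp add: L2_kernel_def)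
  ultimately have "AE y in M. integrable M (\<lambda>x. complex_of_real (R x y) * f x)
      \<and> cmod (integral_op M R f y) = p y"
    using eig unfolding TF
  proof eventually_elim
    case (elim y)
    then have "p y = r * cmod (f y)"
      by (simp add: F_def flip: of_real_mult)
    then show ?case using elim r_pos by (simp add: norm_mult)
  qed
  then obtain y where y: "y \<in> space M" and int: "integrable M (\<lambda>x. complex_of_real (R x y) * f x)"
    and eq: "cmod (integral_op M R f y) = p y"
    using AE_imp_ex by blast
  define I where "I = integral_op M R f y"
  \<comment> \<open>The unimodular factor that rotates \<open>T f y\<close> onto the nonnegative
    real axis; if \<open>T f y = 0\<close> any phase does, and 1 is taken.\<close>
  define c where "c = (if I = 0 then 1 else cnj I / of_real (cmod I))"
  have c: "cmod c = 1" "c * I = of_real (cmod I)"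
    using complex_norm_square[of I]
    by (auto simp: c_def norm_divide field_simps power2_eq_square)
  have int1: "integrable M (\<lambda>x. R x y * cmod (f x))"
    using integrable_norm[OF int]
    by (rule Bochner_Integration.integrable_cong[THEN iffD1, rotated -1]) (use pos y in \<open>auto simp: norm_mult abs_of_pos\<close>)
  have int2: "integrable M (\<lambda>x. Re (c * (complex_of_real (R x y) * f x)))"
    using int by (intro integrable_Re integrable_mult_right)
  have "(LINT x|M. R x y * cmod (f x) - Re (c * (complex_of_real (R x y) * f x)))
      = p y - Re (c * I)"
    using integral_Re[OF integrable_mult_right[OF int, of c]] int1 int2
    by (simp add: p_def I_def integral_op_def del: times_complex.sel)
  also have "\<dots> = 0" using c(2) eq by (simp add: I_def)
  finally have zero: "(LINT x|M. R x y * cmod (f x) - Re (c * (complex_of_real (R x y) * f x))) = 0" .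
  \<comment> \<open>The defect in the triangle inequality becomes \<open>R x y\<close> times a
    nonnegative function of \<open>c * f x\<close>. It has integral 0 and \<open>R x y > 0\<close>,
    so \<open>c * f\<close> equals its own modulus almost everywhere.\<close>
  have factor: "R x y * cmod (f x) - Re (c * (complex_of_real (R x y) * f x))
      = R x y * (cmod (c * f x) - Re (c * f x))" for x
    using c(1) by (simp add: norm_mult algebra_simps)
  have "AE x in M. 0 \<le> R x y * cmod (f x) - Re (c * (complex_of_real (R x y) * f x))"
    using AE_space
  proof eventually_elim
    case (elim x)
    show ?case unfolding factor
      using pos[OF elim y] complex_Re_le_cmod[of "c * f x"] by (intro mult_nonneg_nonneg) simp_all
  qed
  with zero have "AE x in M. R x y * cmod (f x) - Re (c * (complex_of_real (R x y) * f x)) = 0"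
    using integral_nonneg_eq_0_iff_AE[OF Bochner_Integration.integrable_diff[OF int1 int2]] by blast
  then have phase: "AE x in M. c * f x = F x"
    using AE_space
  proof eventually_elim
    case (elim x)
    then have "cmod (c * f x) = Re (c * f x)"
      unfolding factor using pos[OF elim(2) y] by simp
    then have "c * f x = of_real (cmod (c * f x))" by (rule cmod_eq_Re_imp_of_real)
    then show ?case using c(1) by (simp add: F_def norm_mult)
  qed
  have "inner_L2 M F w = inner_L2 M (\<lambda>x. c * f x) w"
    using phase by (intro inner_L2_cong_AE F L2_mult_left f w_L2) auto
  then have "inner_L2 M F w = 0" using orth by (simp add: inner_L2_mult_left)
  then have "AE x in M. F x = 0"
    by (intro inner_L2_ae_positive_eq_0[OF F w_L2 w(2)]) (simp_all add: F_def)
  then show ?thesis by eventually_elim (simp add: F_def)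
qed

end

section \<open>The spectrum of a compact operator and of its deflation\<close>

lemma eigenvalue_in_spectrum_L2:
  assumes A: "bounded_L2 M A" and f: "eigenfunction_L2 M A z f"
  shows "z \<in> spectrum_L2 M A"
proof (rule ccontr)
  assume "z \<notin> spectrum_L2 M A"
  then obtain S where S: "bounded_L2 M S"
    and left: "\<And>f. f \<in> L2 M \<Longrightarrow> AE x in M. S (\<lambda>y. A f y - z * f y) x = f x"
    unfolding spectrum_L2_def by blast
  have fL: "f \<in> L2 M" and nz: "\<not> (AE x in M. f x = 0)" and eig: "AE x in M. A f x = z * f x"
    using f by (auto simp: eigenfunction_L2_def)
  have "AE x in M. S (\<lambda>y. A f y - z * f y) x = S (\<lambda>y. 0) x"
    by (rule bounded_L2_cong_AE[OF S bounded_L2_closed[OF bounded_L2_minus_scalar[OF A] fL] L2_zero])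
      (use eig in simp)
  moreover have "AE x in M. S (\<lambda>y. 0) x = 0"
    using linear_L2_mult[OF bounded_L2_linear[OF S] L2_zero, of 0] by simp
  ultimately have "AE x in M. f x = 0"
    using left[OF fL] by eventually_elim simp
  with nz show False ..
qed

text \<open>A real supremum is an upper bound only if the set is bounded. Nonzero spectral values
  are eigenvalues, and those are bounded by any operator bound; the filter \<open>Z\<close> admits
  the set without \<open>r\<close> that defines the second modulus.\<close>

lemma bdd_above_spectrum_L2:
  assumes A: "compact_L2 M A"
  shows "bdd_above {cmod z | z. z \<in> spectrum_L2 M A \<and> Z z}"
proof -
  note bA = compact_imp_bounded_L2[OF A]
  obtain B where B: "B > 0" "\<And>f. f \<in> L2 M \<Longrightarrow> norm_L2 M (A f) \<le> B * norm_L2 M f"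
    using bounded_L2_bound[OF bA] by metis
  have "cmod z \<le> B" if z: "z \<in> spectrum_L2 M A" for z
  proof (cases "z = 0")
    case False
    obtain f where f: "f \<in> L2 M" "\<not> (AE x in M. f x = 0)" "AE x in M. A f x = z * f x"
      using Fredholm_alternative_L2[OF A False z] by (auto simp: eigenfunction_L2_def)
    have "norm_L2 M f > 0"
      using norm_L2_eq_0_iff[OF f(1)] f(2) norm_L2_nonneg[of M f] by linarith
    moreover have "cmod z * norm_L2 M f \<le> B * norm_L2 M f"
      using B(2)[OF f(1)] norm_L2_cong_AE[OF bounded_L2_closed[OF bA f(1)] L2_mult_left[OF f(1)] f(3)]
      by (simp add: norm_L2_mult_left)
    ultimately show ?thesis by simp
  qed (use B in simp)
  then show ?thesis by (intro bdd_aboveI[of _ B]) auto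
qed

lemma second_modulus_L2_nonneg:
  assumes "compact_L2 M A"
  shows "0 \<le> second_modulus_L2 M A"
proof (cases "{cmod z | z. z \<in> spectrum_L2 M A \<and> z \<noteq> of_real (spectral_radius_L2 M A)} = {}")
  case False
  then obtain z where z: "z \<in> spectrum_L2 M A" "z \<noteq> of_real (spectral_radius_L2 M A)" by blast
  have "cmod z \<le> second_modulus_L2 M A"
    using z False bdd_above_spectrum_L2[OF assms]
    by (auto simp: second_modulus_L2_def Sup_or_zero_def intro!: cSup_upper)
  then show ?thesis using norm_ge_zero order_trans by blast
qed (simp add: second_modulus_L2_def Sup_or_zero_def)

lemma cmod_le_second_modulus_L2:
  assumes "compact_L2 M A" "z \<in> spectrum_L2 M A" "z \<noteq> of_real (spectral_radius_L2 M A)"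
  shows "cmod z \<le> second_modulus_L2 M A"
  using assms(2,3) bdd_above_spectrum_L2[OF assms(1)]
  by (auto simp: second_modulus_L2_def Sup_or_zero_def intro!: cSup_upper)

section \<open>The projections \<open>P\<close> and \<open>Q\<close>\<close>

lemma bounded_L2_proj_P:
  assumes v: "v \<in> L2 M" and w: "w \<in> L2 M"
  shows "bounded_L2 M (proj_P M v w)"
proof -
  have bd: "norm_L2 M (proj_P M v w f) \<le> (norm_L2 M w * norm_L2 M v) * norm_L2 M f" if f: "f \<in> L2 M" for f
    using mult_right_mono[OF inner_L2_Cauchy_Schwarz[OF f w] norm_L2_nonneg[of M v]]
    unfolding proj_P_def norm_L2_mult_left by (simp add: mult_ac)
  have lin: "linear_L2 M (proj_P M v w)"
    unfolding linear_L2_def proj_P_def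
    by (simp add: L2_mult_left v w inner_L2_add_left inner_L2_mult_left distrib_right mult.assoc)
  show ?thesis
    unfolding bounded_L2_def using lin bd by blast
qed

lemma bounded_L2_proj_Q:
  assumes "v \<in> L2 M" "w \<in> L2 M"
  shows "bounded_L2 M (proj_Q M v w)"
proof -
  have "proj_Q M v w = (\<lambda>f x. (-1) * proj_P M v w f x + 1 * f x)"
    by (simp add: proj_P_def proj_Q_def fun_eq_iff)
  then show ?thesis
    using bounded_L2_shift[OF bounded_L2_proj_P[OF assms], of "-1" 1] by simp
qed

lemma inner_L2_proj_Q:
  assumes "v \<in> L2 M" "w \<in> L2 M" "inner_L2 M v w = 1" "f \<in> L2 M"
  shows "inner_L2 M (proj_Q M v w f) w = 0"
  using inner_L2_diff_left[OF assms(4) L2_mult_left[OF assms(1)] assms(2)] assms(3)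
  by (simp add: proj_Q_def inner_L2_mult_left)

section \<open>Deflation by \<open>Q\<close> and the rate of convergence\<close>

locale deflation_L2 = positive_kernel_L2 +
  assumes compact: "compact_L2 M (integral_op M R)"
    and radius: "r = spectral_radius_L2 M (integral_op M R)"
    and normalized: "inner_L2 M v w = 1"
begin

abbreviation "T \<equiv> integral_op M R"
abbreviation "Q \<equiv> proj_Q M v w"

lemmas T_bounded = compact_imp_bounded_L2[OF compact]
lemmas Q_bounded = bounded_L2_proj_Q[OF v_L2 w_L2]
lemmas Q_L2 = bounded_L2_closed[OF Q_bounded]

lemma TQ_compact: "compact_L2 M (T \<circ> Q)"
  by (rule compact_L2_comp_bounded[OF compact Q_bounded])

lemmas TQ_bounded = compact_imp_bounded_L2[OF TQ_compact]
lemmas TQ_power_L2 = bounded_L2_closed[OF bounded_L2_funpow[OF TQ_bounded]]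

text \<open>An equality of functions, not merely almost everywhere, as 0 times \<open>v\<close> is
  subtracted; it can be rewritten under operators directly.\<close>

lemma proj_Q_orthogonal: "inner_L2 M f w = 0 \<Longrightarrow> Q f = f"
  by (simp add: proj_Q_def)

text \<open>\<open>T\<close> multiplies the inner product with \<open>w\<close> by \<open>r\<close>,
  so it preserves orthogonality to \<open>w\<close>. Hence \<open>Q\<close> acts as the identity on
  the range of \<open>T Q\<close>.\<close>

lemma inner_TQ: "f \<in> L2 M \<Longrightarrow> inner_L2 M (T (Q f)) w = 0"
  using inner_integral_op[OF Q_L2] inner_L2_proj_Q[OF v_L2 w_L2 normalized] by simp

lemma T_eigen_v: "AE x in M. T (\<lambda>y. c * v y) x = of_real r * (c * v x)"
proof -
  have "AE x in M. T v x = of_real r * v x" using v(1) by (simp add: eigenfunction_L2_def)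
  with linear_L2_mult[OF bounded_L2_linear[OF T_bounded] v_L2, of c]
  show ?thesis by eventually_elim simp
qed

text \<open>The induction starts at 1: for \<open>k = 0\<close> the last term would be
  \<open>f\<close> instead of \<open>Q f\<close>.\<close>

lemma power_decomposition:
  assumes f: "f \<in> L2 M" and "k \<ge> 1"
  shows "AE x in M. (T ^^ k) f x = of_real (r ^ k) * inner_L2 M f w * v x + ((T \<circ> Q) ^^ k) f x"
  using \<open>k \<ge> 1\<close>
proof (induction k rule: nat_induct_at_least)
  case base
  show ?case
    using linear_L2_diff[OF bounded_L2_linear[OF T_bounded] f L2_mult_left[OF v_L2], of "inner_L2 M f w"]
      T_eigen_v[of "inner_L2 M f w"]
    by eventually_elim (simp add: proj_Q_def)
next
  case (Suc k)
  let ?c = "of_real (r ^ k) * inner_L2 M f w"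
  let ?g = "((T \<circ> Q) ^^ k) f"
  \<comment> \<open>Exposes an outermost factor \<open>T Q\<close>, which puts \<open>?g\<close> in
    its range and therefore makes \<open>Q ?g = ?g\<close>.\<close>
  obtain m where m: "k = Suc m" using Suc.hyps by (cases k) auto
  have g: "?g \<in> L2 M" by (rule TQ_power_L2[OF f])
  have "inner_L2 M ?g w = 0"
    unfolding m using inner_TQ[OF TQ_power_L2[OF f, of m]] by simp
  then have Qg: "Q ?g = ?g" by (rule proj_Q_orthogonal)
  have cong: "AE x in M. T ((T ^^ k) f) x = T (\<lambda>x. ?c * v x + ?g x) x"
    using bounded_L2_cong_AE[OF T_bounded
        bounded_L2_closed[OF bounded_L2_funpow[OF T_bounded] f] L2_add[OF L2_mult_left[OF v_L2] g] Suc.IH] .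
  have add: "AE x in M. T (\<lambda>x. ?c * v x + ?g x) x = T (\<lambda>x. ?c * v x) x + T ?g x"
    by (rule linear_L2_add[OF bounded_L2_linear[OF T_bounded] L2_mult_left[OF v_L2] g])
  have Suc_k: "(T ^^ Suc k) f = T ((T ^^ k) f)" "((T \<circ> Q) ^^ Suc k) f = T ?g"
    by (simp_all only: funpow.simps comp_apply Qg)
  show ?case
    unfolding Suc_k using cong add T_eigen_v[of ?c] by eventually_elim simp
qed

lemma spectrum_TQ:
  assumes z: "z \<in> spectrum_L2 M (T \<circ> Q)"
  shows "cmod z \<le> second_modulus_L2 M T"
proof (cases "z = 0")
  case True
  then show ?thesis using second_modulus_L2_nonneg[OF compact] by simp
next
  case False
  obtain f where f: "f \<in> L2 M" and nz: "\<not> (AE x in M. f x = 0)"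
    and eig: "AE x in M. T (Q f) x = z * f x"
    using Fredholm_alternative_L2[OF TQ_compact False z] by (auto simp: eigenfunction_L2_def)
  have "z * inner_L2 M f w = inner_L2 M (T (Q f)) w"
    using inner_L2_cong_AE[OF closed[OF Q_L2[OF f]] L2_mult_left[OF f] w_L2 eig]
    by (simp add: inner_L2_mult_left)
  then have orth: "inner_L2 M f w = 0"
    using False inner_TQ[OF f] by simp
  then have Tf: "AE x in M. T f x = z * f x"
    using eig by (simp add: proj_Q_orthogonal)
  \<comment> \<open>This case must be excluded since the supremum defining the second modulus omits
    \<open>r\<close>.\<close>
  then have "z \<noteq> of_real r"
    using eigenfunction_orthogonal_eq_0[OF f _ orth] nz by blast
  moreover have "z \<in> spectrum_L2 M T"
    using Tf f nz by (intro eigenvalue_in_spectrum_L2[OF T_bounded]) (auto simp: eigenfunction_L2_def)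
  ultimately show ?thesis
    using cmod_le_second_modulus_L2[OF compact] radius by simp
qed

lemma TQ_power_bound:
  assumes "\<epsilon> > 0"
  obtains K where "K > 0" and "\<And>k f. f \<in> L2 M \<Longrightarrow>
    norm_L2 M (((T \<circ> Q) ^^ k) f) \<le> K * (second_modulus_L2 M T + \<epsilon>) ^ k * norm_L2 M f"
proof (rule power_bound_of_spectrum_L2[OF TQ_bounded second_modulus_L2_nonneg[OF compact]])
  show "second_modulus_L2 M T < second_modulus_L2 M T + \<epsilon>" using assms by simp
qed (erule spectrum_TQ, rule that)

text \<open>Dividing the decomposition by \<open>r^k\<close> times the coefficient of
  \<open>f\<close> along \<open>v\<close> turns its first term into exactly \<open>v\<close>, so the
  error is a scalar multiple of \<open>(T Q)^k f\<close>.\<close>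

lemma normalized_power:
  assumes f: "f \<in> L2 M" and nz: "inner_L2 M f w \<noteq> 0" and k: "k \<ge> 1"
  shows "norm_L2 M (\<lambda>x. (T ^^ k) f x / (of_real (r ^ k) * inner_L2 M f w) - v x)
    = inverse (r ^ k * cmod (inner_L2 M f w)) * norm_L2 M (((T \<circ> Q) ^^ k) f)"
proof -
  let ?a = "of_real (r ^ k) * inner_L2 M f w"
  have a: "?a \<noteq> 0" using r_pos nz by simp
  have TkL: "(T ^^ k) f \<in> L2 M" by (rule bounded_L2_closed[OF bounded_L2_funpow[OF T_bounded] f])
  have "norm_L2 M (\<lambda>x. (T ^^ k) f x / ?a - v x) = norm_L2 M (\<lambda>x. inverse ?a * ((T \<circ> Q) ^^ k) f x)"
  proof (rule norm_L2_cong_AE)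
    show "(\<lambda>x. (T ^^ k) f x / ?a - v x) \<in> L2 M"
      using L2_diff[OF L2_mult_left[OF TkL, of "inverse ?a"] v_L2] by (simp add: divide_inverse mult.commute)
    show "(\<lambda>x. inverse ?a * ((T \<circ> Q) ^^ k) f x) \<in> L2 M"
      by (rule L2_mult_left[OF TQ_power_L2[OF f]])
    show "AE x in M. (T ^^ k) f x / ?a - v x = inverse ?a * ((T \<circ> Q) ^^ k) f x"
      using power_decomposition[OF f k]
    proof eventually_elim
      case (elim x)
      show ?case unfolding elim using a by (simp add: field_simps)
    qed
  qed
  also have "\<dots> = cmod (inverse ?a) * norm_L2 M (((T \<circ> Q) ^^ k) f)"
    by (rule norm_L2_mult_left)
  also have "cmod (inverse ?a) = inverse (r ^ k * cmod (inner_L2 M f w))"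
    using r_pos by (simp add: norm_inverse norm_mult norm_power)
  finally show ?thesis .
qed

text \<open>The constant \<open>K + 1\<close> serves both estimates; the added 1, together with
  \<open>s > 0\<close>, gives the strict inequality for the operator norm.\<close>

lemma rate_of_convergence:
  assumes "\<epsilon> > 0"
  defines "s \<equiv> second_modulus_L2 M T + \<epsilon>"
  shows "\<exists>C>0. (\<forall>k\<ge>1. bounded_L2 M ((T \<circ> Q) ^^ k) \<and> op_norm_L2 M ((T \<circ> Q) ^^ k) < C * s ^ k) \<and>
    (\<forall>f\<in>L2 M. inner_L2 M f w \<noteq> 0 \<longrightarrow> (\<forall>k\<ge>1.
       norm_L2 M (\<lambda>x. (T ^^ k) f x / (of_real (r ^ k) * inner_L2 M f w) - v x)
         \<le> C * inverse (cmod (inner_L2 M f w)) * norm_L2 M f * (s / r) ^ k))"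
proof -
  have s: "s > 0" using assms(1) second_modulus_L2_nonneg[OF compact] by (simp add: s_def)
  obtain K where K: "K > 0" and bd: "\<And>k f. f \<in> L2 M \<Longrightarrow>
      norm_L2 M (((T \<circ> Q) ^^ k) f) \<le> K * s ^ k * norm_L2 M f"
    using TQ_power_bound[OF assms(1)] unfolding s_def by blast
  have op: "op_norm_L2 M ((T \<circ> Q) ^^ k) < (K + 1) * s ^ k" for k
  proof -
    have "op_norm_L2 M ((T \<circ> Q) ^^ k) \<le> K * s ^ k"
      unfolding op_norm_L2_def
    proof (rule cSup_least)
      \<comment> \<open>The least-upper-bound rule for reals requires a nonempty set; the zero
        function provides an element.\<close>
      show "{norm_L2 M (((T \<circ> Q) ^^ k) f) |f. f \<in> L2 M \<and> norm_L2 M f \<le> 1} \<noteq> {}"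
        unfolding ex_in_conv[symmetric]
        by (intro exI CollectI conjI, rule refl, rule L2_zero) simp
      fix n assume "n \<in> {norm_L2 M (((T \<circ> Q) ^^ k) f) |f. f \<in> L2 M \<and> norm_L2 M f \<le> 1}"
      then obtain f where f: "f \<in> L2 M" "norm_L2 M f \<le> 1" "n = norm_L2 M (((T \<circ> Q) ^^ k) f)" by blast
      have "K * s ^ k * norm_L2 M f \<le> K * s ^ k * 1"
        using K s f(2) by (intro mult_left_mono) auto
      with bd[OF f(1), of k] f(3) show "n \<le> K * s ^ k" by simp
    qed
    also have "\<dots> < (K + 1) * s ^ k" using s by simp
    finally show ?thesis .
  qed
  have conv: "norm_L2 M (\<lambda>x. (T ^^ k) f x / (of_real (r ^ k) * inner_L2 M f w) - v x)
      \<le> (K + 1) * inverse (cmod (inner_L2 M f w)) * norm_L2 M f * (s / r) ^ k"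
    if f: "f \<in> L2 M" and nz: "inner_L2 M f w \<noteq> 0" and k: "k \<ge> 1" for f k
  proof -
    have "norm_L2 M (((T \<circ> Q) ^^ k) f) \<le> (K + 1) * s ^ k * norm_L2 M f"
      by (rule order_trans[OF bd[OF f]]) (use s in \<open>simp add: mult_right_mono\<close>)
    then have "inverse (r ^ k * cmod (inner_L2 M f w)) * norm_L2 M (((T \<circ> Q) ^^ k) f)
        \<le> inverse (r ^ k * cmod (inner_L2 M f w)) * ((K + 1) * s ^ k * norm_L2 M f)"
      using r_pos by (intro mult_left_mono) auto
    also have "\<dots> = (K + 1) * inverse (cmod (inner_L2 M f w)) * norm_L2 M f * (s / r) ^ k"
      by (simp add: divide_inverse power_mult_distrib power_inverse mult_ac)
    finally show ?thesis unfolding normalized_power[OF f nz k] .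
  qed
  show ?thesis
    using K by (intro exI[of _ "K + 1"] conjI allI ballI impI op conv bounded_L2_funpow[OF TQ_bounded]) simp
qed

end

theorem lemma3p1:
  fixes M :: "'a measure"
    and R :: "'a \<Rightarrow> 'a \<Rightarrow> real"
    and T P Q :: "('a \<Rightarrow> complex) \<Rightarrow> ('a \<Rightarrow> complex)"
    and v w :: "'a \<Rightarrow> complex"
    and r lambda2 :: real
  assumes "sigma_finite_measure M"
    and "(\<lambda>(x, y). R x y) \<in> borel_measurable (M \<Otimes>\<^sub>M M)"
    and "\<forall>x \<in> space M. \<forall>y \<in> space M. 0 < R x y"
    and "L2_kernel M R"
    and T: "T = integral_op M R"
    and "compact_L2 M T"
    and r: "r = spectral_radius_L2 M T"
    and "eigenfunction_L2 M T (of_real r) v" and "ae_positive M v"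
    and "eigenfunction_L2 M (adjoint_integral_op M R) (of_real r) w" and "ae_positive M w"
    and "inner_L2 M v w = 1"
    and P: "P = proj_P M v w"
    and Q: "Q = proj_Q M v w"
    and lambda2: "lambda2 = second_modulus_L2 M T"
  shows "bounded_L2 M P \<and> bounded_L2 M Q \<and>
         (\<forall>f \<in> L2 M. (AE x in M. P (P f) x = P f x) \<and> (AE x in M. Q (Q f) x = Q f x) \<and>
                     (AE x in M. f x = P f x + Q f x)) \<and>
         (\<forall>f \<in> L2 M. \<forall>k \<ge> 1. AE x in M.
            (T ^^ k) f x = of_real (r ^ k) * inner_L2 M f w * v x + ((T \<circ> Q) ^^ k) f x) \<and>
         (\<forall>\<epsilon> > 0. \<exists>C > 0.
            (\<forall>k \<ge> 1. bounded_L2 M ((T \<circ> Q) ^^ k) \<and>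
                     op_norm_L2 M ((T \<circ> Q) ^^ k) < C * (lambda2 + \<epsilon>) ^ k) \<and>
            (\<forall>f \<in> L2 M. inner_L2 M f w \<noteq> 0 \<longrightarrow>
               (\<forall>k \<ge> 1.
                  norm_L2 M (\<lambda>x. (T ^^ k) f x / (of_real (r ^ k) * inner_L2 M f w) - v x)
                    \<le> C * inverse (cmod (inner_L2 M f w)) * norm_L2 M f
                        * ((lambda2 + \<epsilon>) / r) ^ k)))"
proof -
  have "deflation_L2 M R r v w"
    unfolding deflation_L2_def positive_kernel_L2_def positive_kernel_L2_axioms_def deflation_L2_axioms_def
    using assms bounded_L2_closed[OF compact_imp_bounded_L2, of M T] by simp
  then interpret deflation_L2 M R r v w .
  have P_proj: "P (P f) = P f" for f
    by (simp add: P proj_P_def inner_L2_mult_left normalized)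
  have Q_proj: "Q (Q f) = Q f" if "f \<in> L2 M" for f
    unfolding Q by (rule proj_Q_orthogonal[OF inner_L2_proj_Q[OF v_L2 w_L2 normalized that]])
  show ?thesis
    unfolding lambda2
  proof (intro conjI ballI allI impI)
    show "bounded_L2 M P" unfolding P by (rule bounded_L2_proj_P[OF v_L2 w_L2])
    show "bounded_L2 M Q" unfolding Q by (rule Q_bounded)
  next
    fix f assume "f \<in> L2 M"
    then show "AE x in M. P (P f) x = P f x" "AE x in M. Q (Q f) x = Q f x"
      "AE x in M. f x = P f x + Q f x"
      by (simp_all add: P_proj Q_proj) (simp add: P Q proj_P_def proj_Q_def)
  next
    fix f and k :: nat assume "f \<in> L2 M" "k \<ge> 1"
    then show "AE x in M. (T ^^ k) f x = of_real (r ^ k) * inner_L2 M f w * v x + ((T \<circ> Q) ^^ k) f x"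
      unfolding T Q by (rule power_decomposition)
  qed (unfold T Q, rule rate_of_convergence)
qed

end
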